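(* A connected graph $\Gamma$ is a locally-finite connected-homogeneous bipartite graph if and only if $\Gamma$ is isomorphic to one of the following: a cycle $C_m$ with $m$ even; an infinite semiregular tree $T_{a,b}$ ($a,b\in\mathbb{N}$); a complete bipartite graph $K_{m,n}$ ($m,n\in\mathbb{N}$); the complement of a perfect matching.
   Context: Let $\Gamma$ be a bipartite graph with a given bipartition $X\cup Y$. An automorphism of the bipartite graph is a graph automorphism $\varphi$ with $\varphi(X)=X$, $\varphi(Y)=Y$. $\Gamma$ is a connected-homogeneous bipartite graph if every isomorphism between finite connected induced subgraphs that maps vertices of $X$ to vertices of $X$ and vertices of $Y$ to vertices of $Y$ extends to an automorphism of the bipartite graph $\Gamma$. Locally-finite means every vertex has finite degree. $T_{a,b}$ denotes the infinite tree in which every vertex of one part of the bipartition has degree $a$ and every vertex of the other has degree $b$. The complement of a perfect matching on $2n$ vertices is the bipartite graph with parts $X,Y$ of size $n$, a bijection $\eta:X\to Y$, and $x\sim y$ iff $y\neq\eta(x)$. *)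

theory Defs
  imports Main
begin

definition bipartite_graph :: "'a set \<Rightarrow> ('a \<Rightarrow> 'a \<Rightarrow> bool) \<Rightarrow> 'a set \<Rightarrow> 'a set \<Rightarrow> bool" where
  "bipartite_graph V E X Y \<longleftrightarrow>
     X \<union> Y = V \<and> X \<inter> Y = {} \<and>
     (\<forall>x y. E x y \<longrightarrow> E y x) \<and>
     (\<forall>x y. E x y \<longrightarrow> (x \<in> X \<and> y \<in> Y) \<or> (x \<in> Y \<and> y \<in> X))"

definition graph_connected :: "'a set \<Rightarrow> ('a \<Rightarrow> 'a \<Rightarrow> bool) \<Rightarrow> bool" where
  "graph_connected V E \<longleftrightarrow> V \<noteq> {} \<and>
     (\<forall>x\<in>V. \<forall>y\<in>V. (\<lambda>u v. E u v \<and> u \<in> V \<and> v \<in> V)\<^sup>*\<^sup>* x y)"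

definition locally_finite :: "'a set \<Rightarrow> ('a \<Rightarrow> 'a \<Rightarrow> bool) \<Rightarrow> bool" where
  "locally_finite V E \<longleftrightarrow> (\<forall>v\<in>V. finite {u\<in>V. E v u})"

definition c_homogeneous_bipartite :: "'a set \<Rightarrow> ('a \<Rightarrow> 'a \<Rightarrow> bool) \<Rightarrow> 'a set \<Rightarrow> 'a set \<Rightarrow> bool" where
  "c_homogeneous_bipartite V E X Y \<longleftrightarrow>
     (\<forall>S f. finite S \<and> S \<subseteq> V \<and>
        graph_connected S (\<lambda>u v. E u v \<and> u \<in> S \<and> v \<in> S) \<and>
        inj_on f S \<and> f ` S \<subseteq> V \<and>
        graph_connected (f ` S) (\<lambda>u v. E u v \<and> u \<in> f ` S \<and> v \<in> f ` S) \<and>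
        (\<forall>x\<in>S. \<forall>y\<in>S. E x y \<longleftrightarrow> E (f x) (f y)) \<and>
        f ` (S \<inter> X) \<subseteq> X \<and> f ` (S \<inter> Y) \<subseteq> Y
      \<longrightarrow> (\<exists>\<phi>. bij_betw \<phi> V V \<and> \<phi> ` X = X \<and> \<phi> ` Y = Y \<and>
              (\<forall>x\<in>V. \<forall>y\<in>V. E x y \<longleftrightarrow> E (\<phi> x) (\<phi> y)) \<and>
              (\<forall>x\<in>S. \<phi> x = f x)))"

definition graph_iso :: "'a set \<Rightarrow> ('a \<Rightarrow> 'a \<Rightarrow> bool) \<Rightarrow> 'b set \<Rightarrow> ('b \<Rightarrow> 'b \<Rightarrow> bool) \<Rightarrow> ('a \<Rightarrow> 'b) \<Rightarrow> bool" where
  "graph_iso V E V' E' f \<longleftrightarrow> bij_betw f V V' \<and> (\<forall>x\<in>V. \<forall>y\<in>V. E x y \<longleftrightarrow> E' (f x) (f y))"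

definition graph_isomorphic :: "'a set \<Rightarrow> ('a \<Rightarrow> 'a \<Rightarrow> bool) \<Rightarrow> 'b set \<Rightarrow> ('b \<Rightarrow> 'b \<Rightarrow> bool) \<Rightarrow> bool" where
  "graph_isomorphic V E V' E' \<longleftrightarrow> (\<exists>f. graph_iso V E V' E' f)"

definition cycle_E :: "nat \<Rightarrow> nat \<Rightarrow> nat \<Rightarrow> bool" where
  "cycle_E m i j \<longleftrightarrow> i < m \<and> j < m \<and> (j = (i + 1) mod m \<or> i = (j + 1) mod m)"

definition Kmn_E :: "nat \<Rightarrow> nat \<Rightarrow> nat \<Rightarrow> nat \<Rightarrow> bool" where
  "Kmn_E m n i j \<longleftrightarrow> (i < m \<and> m \<le> j \<and> j < m + n) \<or> (j < m \<and> m \<le> i \<and> i < m + n)"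

text \<open>Complement of a perfect matching on 2n vertices: parts {0..<n}, {n..<2n},
  with eta(i) = n + i; i ~ j iff j is in the other part and j is not eta(i).\<close>
definition cpm_E :: "nat \<Rightarrow> nat \<Rightarrow> nat \<Rightarrow> bool" where
  "cpm_E n i j \<longleftrightarrow> (i < n \<and> n \<le> j \<and> j < 2 * n \<and> j \<noteq> n + i)
                  \<or> (j < n \<and> n \<le> i \<and> i < 2 * n \<and> i \<noteq> n + j)"

definition graph_acyclic :: "'a set \<Rightarrow> ('a \<Rightarrow> 'a \<Rightarrow> bool) \<Rightarrow> bool" where
  "graph_acyclic V E \<longleftrightarrow> \<not> (\<exists>ps. length ps \<ge> 3 \<and> distinct ps \<and> set ps \<subseteq> V \<and>
       (\<forall>i. i + 1 < length ps \<longrightarrow> E (ps ! i) (ps ! (i + 1))) \<and> E (last ps) (hd ps))"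

definition is_T :: "'a set \<Rightarrow> ('a \<Rightarrow> 'a \<Rightarrow> bool) \<Rightarrow> 'a set \<Rightarrow> 'a set \<Rightarrow> nat \<Rightarrow> nat \<Rightarrow> bool" where
  "is_T V E X Y a b \<longleftrightarrow> infinite V \<and> graph_connected V E \<and> graph_acyclic V E \<and>
     (\<forall>x\<in>X. finite {u\<in>V. E x u} \<and> card {u\<in>V. E x u} = a) \<and>
     (\<forall>y\<in>Y. finite {u\<in>V. E y u} \<and> card {u\<in>V. E y u} = b)"

end

theory Submission
  imports Defs
begin

text \<open>
  Complete bipartite graphs and complements of perfect matchings are homogeneous because partial
  injections of finite sets extend to permutations; in a cycle an isomorphism is determined by the
  image of one arc; in a semiregular tree partial isomorphisms extend vertex by vertex.

  Conversely, let \<open>\<Gamma>\<close> be connected-homogeneous; degrees are constant on each part. If \<open>\<Gamma>\<close> is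
  acyclic, it is an infinite semiregular tree or a star, and if all degrees are two, it is a cycle.
  Otherwise consider the girth. If there are no squares, moving the last vertex of the path
  \<open>c\<^sub>0 \<dots> c\<^sub>n\<^sub>-\<^sub>2\<close> in a shortest cycle shows that the girth is six and that \<open>\<Gamma>\<close> is the incidence
  graph of a projective plane, in which a collinear and a non-collinear triple span isomorphic
  trees. If there are squares, let two vertices with a common neighbour have \<open>k\<close> common
  neighbours and let \<open>a\<close> be their degree. Permuting the neighbourhood of a vertex \<open>x\<close> shows
  that every \<open>k\<close>-subset of it is cut out by another neighbourhood, while homogeneity of stars
  makes any two such subsets that meet have the same intersection size. Hence \<open>k = a\<close> (complete
  bipartite), \<open>k = a - 1\<close> (complement of a perfect matching) or \<open>k = 2\<close>; if \<open>k = 2\<close> and \<open>a \<ge> 4\<close>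
  on both sides, two paths with five vertices are isomorphic but inequivalent.
\<close>

section \<open>Connected vertex sets\<close>

text \<open>\<open>c_homogeneous_bipartite\<close> restricts the edges to \<open>S\<close>, and
  \<open>graph_connected\<close> restricts them again; restriction is idempotent, so induced
  connectivity can be handled with \<open>E\<close> itself.\<close>

lemma graph_connected_induced:
  "graph_connected S (\<lambda>u v. E u v \<and> u \<in> S \<and> v \<in> S) \<longleftrightarrow> graph_connected S E"
proof -
  have "(\<lambda>u v. (E u v \<and> u \<in> S \<and> v \<in> S) \<and> u \<in> S \<and> v \<in> S) = (\<lambda>u v. E u v \<and> u \<in> S \<and> v \<in> S)"
    by auto
  then show ?thesis unfolding graph_connected_def by simp
qed

lemma graph_connected_singleton: "graph_connected {v} E"
  unfolding graph_connected_def by simp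

lemma graph_connected_insert:
  assumes S: "graph_connected S E" and u: "u \<in> S" and uv: "E u v" "E v u"
  shows "graph_connected (insert v S) E"
proof -
  let ?R = "\<lambda>T a b. E a b \<and> a \<in> T \<and> b \<in> T"
  let ?T = "insert v S"
  have mono: "(?R ?T)\<^sup>*\<^sup>* x y" if "(?R S)\<^sup>*\<^sup>* x y" for x y
    using that by (rule rtranclp_mono[THEN predicate2D, rotated]) auto
  have old: "(?R ?T)\<^sup>*\<^sup>* x y" if "x \<in> S" "y \<in> S" for x y
    using S that mono unfolding graph_connected_def by blast
  have to_v: "(?R ?T)\<^sup>*\<^sup>* x v" if "x \<in> S" for x
    by (rule rtranclp.rtrancl_into_rtrancl[OF old[OF that u]]) (use u uv in auto)
  have from_v: "(?R ?T)\<^sup>*\<^sup>* v y" if "y \<in> S" for y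
    by (rule converse_rtranclp_into_rtranclp[OF _ old[OF u that]]) (use u uv in auto)
  show ?thesis unfolding graph_connected_def using old to_v from_v by auto
qed

lemma graph_connected_image:
  assumes S: "graph_connected S E" and f: "\<And>x y. x \<in> S \<Longrightarrow> y \<in> S \<Longrightarrow> E x y \<Longrightarrow> E' (f x) (f y)"
  shows "graph_connected (f ` S) E'"
proof -
  let ?R = "\<lambda>E T a b. E a b \<and> a \<in> T \<and> b \<in> T"
  have "(?R E' (f ` S))\<^sup>*\<^sup>* (f x) (f y)" if "(?R E S)\<^sup>*\<^sup>* x y" for x y
    using that
  proof induction
    case (step y z)
    then have "?R E' (f ` S) (f y) (f z)" using f by auto
    with step.IH show ?case by (rule rtranclp.rtrancl_into_rtrancl)
  qed simp
  then show ?thesis using S unfolding graph_connected_def by auto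
qed

text \<open>Any two vertices are joined through the common vertex \<open>r\<close>. This keeps
  domains connected when Zorn's lemma passes to the union of a chain.\<close>

lemma graph_connected_Union:
  assumes ne: "C \<noteq> {}" and C: "\<And>S. S \<in> C \<Longrightarrow> graph_connected S E" "\<And>S. S \<in> C \<Longrightarrow> r \<in> S"
  shows "graph_connected (\<Union>C) E"
proof -
  let ?R = "\<lambda>T a b. E a b \<and> a \<in> T \<and> b \<in> T"
  have mono: "(?R (\<Union>C))\<^sup>*\<^sup>* x y" if "(?R S)\<^sup>*\<^sup>* x y" "S \<in> C" for x y S
    using that(1) by (rule rtranclp_mono[THEN predicate2D, rotated]) (use that(2) in auto)
  have "(?R (\<Union>C))\<^sup>*\<^sup>* x r" "(?R (\<Union>C))\<^sup>*\<^sup>* r x" if "x \<in> S" "S \<in> C" for x S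
    using C[OF that(2)] that mono unfolding graph_connected_def by blast+
  then have "(?R (\<Union>C))\<^sup>*\<^sup>* x y" if "x \<in> \<Union>C" "y \<in> \<Union>C" for x y
    using that by (meson UnionE rtranclp_trans)
  moreover have "\<Union>C \<noteq> {}" using ne C(2) by blast
  ultimately show ?thesis unfolding graph_connected_def by blast
qed

lemma graph_connected_induct:
  assumes S: "graph_connected S E" and r: "r \<in> S" "P r" and x: "x \<in> S"
    and step: "\<And>u v. u \<in> S \<Longrightarrow> v \<in> S \<Longrightarrow> E u v \<Longrightarrow> P u \<Longrightarrow> P v"
  shows "P x"
proof -
  have "(\<lambda>u v. E u v \<and> u \<in> S \<and> v \<in> S)\<^sup>*\<^sup>* r x"
    using S r x unfolding graph_connected_def by blast
  then show ?thesis by induction (use r step in auto)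
qed

lemma graph_connected_ex_neighbour:
  assumes S: "graph_connected S E" and u: "u \<in> S" and ne: "S \<noteq> {u}"
  shows "\<exists>v\<in>S. E u v"
proof (rule ccontr)
  assume no: "\<not> (\<exists>v\<in>S. E u v)"
  have "x = u" if "x \<in> S" for x
    by (rule graph_connected_induct[OF S u _ that]) (use no in auto)
  with u ne show False by blast
qed

text \<open>Loop erasure: when the next vertex already occurs on the path built so far, the path is
  cut back to that occurrence.\<close>

lemma reach_distinct_path:
  assumes "(\<lambda>u v. E u v \<and> u \<in> S \<and> v \<in> S)\<^sup>*\<^sup>* s t" "s \<in> S"
  shows "\<exists>ps. ps \<noteq> [] \<and> distinct ps \<and> set ps \<subseteq> S \<and> successively E ps \<and> hd ps = s \<and> last ps = t"
  using assms
proof induction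
  case base
  then show ?case by (intro exI[of _ "[s]"]) auto
next
  case (step y z)
  then obtain ps where ps: "ps \<noteq> []" "distinct ps" "set ps \<subseteq> S" "successively E ps"
      "hd ps = s" "last ps = y" by blast
  show ?case
  proof (cases "z \<in> set ps")
    case True
    then obtain as bs where eq: "ps = as @ z # bs" by (meson split_list)
    then have "successively E (as @ [z])" using ps(4) by (auto simp: successively_append_iff)
    moreover have "hd (as @ [z]) = s" using ps(5) eq by (cases as) auto
    ultimately show ?thesis using ps eq by (intro exI[of _ "as @ [z]"]) auto
  next
    case False
    with ps step.hyps show ?thesis
      by (intro exI[of _ "ps @ [z]"]) (auto simp: successively_append_iff)
  qed
qed

section \<open>Cycles\<close>

text \<open>This is the cycle notion inside \<open>graph_acyclic\<close>, phrased with
  \<open>successively\<close>. Membership in \<open>V\<close> is left out because edges of a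
  bipartite graph lie in \<open>V\<close>; \<open>graph_acyclic_iff\<close> reconciles the
  two.\<close>

definition cycle_list :: "('a \<Rightarrow> 'a \<Rightarrow> bool) \<Rightarrow> 'a list \<Rightarrow> bool" where
  "cycle_list E ps \<longleftrightarrow> length ps \<ge> 3 \<and> distinct ps \<and> successively E ps \<and> E (last ps) (hd ps)"

lemma cycle_list_rotate1:
  assumes "cycle_list E ps" shows "cycle_list E (rotate1 ps)"
proof -
  obtain x y zs where ps: "ps = x # y # zs" "zs \<noteq> []"
    using assms unfolding cycle_list_def
    by (cases ps; cases "tl ps") (auto simp: Suc_le_eq)
  then show ?thesis
    using assms unfolding cycle_list_def by (auto simp: successively_append_iff successively_Cons)
qed

text \<open>Two different neighbours of \<open>v\<close> in a connected set avoiding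
  \<open>v\<close> are joined by a path inside that set, and \<open>v\<close> closes the path to a
  cycle.\<close>

lemma graph_acyclic_unique_neighbour:
  assumes ac: "graph_acyclic V E" and S: "graph_connected S E" and SV: "S \<subseteq> V"
    and v: "v \<in> V" "v \<notin> S" and st: "s \<in> S" "t \<in> S" and E: "E v s" "E t v"
  shows "s = t"
proof (rule ccontr)
  assume "s \<noteq> t"
  have "(\<lambda>u v. E u v \<and> u \<in> S \<and> v \<in> S)\<^sup>*\<^sup>* s t"
    using S st unfolding graph_connected_def by blast
  from reach_distinct_path[OF this st(1)] obtain ps where
    ps: "ps \<noteq> []" "distinct ps" "set ps \<subseteq> S" "successively E ps" "hd ps = s" "last ps = t" by blast
  have len: "length ps \<ge> 2"
  proof (rule ccontr)
    assume "\<not> length ps \<ge> 2"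
    with ps(1) obtain p where "ps = [p]" by (cases ps; cases "tl ps") auto
    with ps \<open>s \<noteq> t\<close> show False by auto
  qed
  let ?qs = "v # ps"
  have "successively E ?qs" using ps E by (cases ps) (auto simp: successively_Cons)
  then have "\<forall>i. i + 1 < length ?qs \<longrightarrow> E (?qs ! i) (?qs ! (i + 1))"
    by (auto simp: successively_conv_nth)
  moreover have "length ?qs \<ge> 3" "distinct ?qs" "set ?qs \<subseteq> V" "E (last ?qs) (hd ?qs)"
    using len ps v E SV by auto
  ultimately show False using ac unfolding graph_acyclic_def by blast
qed

section \<open>Connected bipartite graphs\<close>

locale connected_bipartite =
  fixes V :: "'a set" and E :: "'a \<Rightarrow> 'a \<Rightarrow> bool" and X Y :: "'a set"
  assumes bip: "bipartite_graph V E X Y" and conn: "graph_connected V E"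
begin

abbreviation N :: "'a \<Rightarrow> 'a set" where "N v \<equiv> {u. E v u}"

lemma V_eq: "V = X \<union> Y" and disj: "X \<inter> Y = {}" and sym: "E x y \<Longrightarrow> E y x"
  and E_cases: "E x y \<Longrightarrow> (x \<in> X \<and> y \<in> Y) \<or> (x \<in> Y \<and> y \<in> X)"
  using bip by (simp_all add: bipartite_graph_def)

lemma in_Y_iff: "v \<in> V \<Longrightarrow> v \<in> Y \<longleftrightarrow> v \<notin> X"
  using V_eq disj by auto

lemma X_V: "x \<in> X \<Longrightarrow> x \<in> V" and Y_V: "x \<in> Y \<Longrightarrow> x \<in> V"
  using V_eq by auto

lemma not_XY: "x \<in> X \<Longrightarrow> x \<in> Y \<Longrightarrow> False"
  using disj by auto

lemma E_XY: "E x y \<Longrightarrow> x \<in> X \<Longrightarrow> y \<in> Y" and E_YX: "E x y \<Longrightarrow> x \<in> Y \<Longrightarrow> y \<in> X"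
  using E_cases[of x y] not_XY by auto

lemma E_V: "E x y \<Longrightarrow> x \<in> V" "E x y \<Longrightarrow> y \<in> V"
  using E_cases[of x y] X_V Y_V by auto

lemma E_X_iff: "E x y \<Longrightarrow> x \<in> X \<longleftrightarrow> y \<notin> X"
  using E_cases[of x y] not_XY by auto

lemma not_E_XX: "x \<in> X \<Longrightarrow> y \<in> X \<Longrightarrow> \<not> E x y" and not_E_YY: "x \<in> Y \<Longrightarrow> y \<in> Y \<Longrightarrow> \<not> E x y"
  using E_XY E_YX not_XY by blast+

lemma not_E_refl: "\<not> E x x"
  using E_X_iff by blast

lemma E_commute: "E x y \<longleftrightarrow> E y x"
  using sym by blast

lemma neighbours_eq: "{u\<in>V. E v u} = N v"
  using E_V by blast

lemma swap: "connected_bipartite V E Y X"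
  using bip conn by unfold_locales (auto simp: bipartite_graph_def)

text \<open>The standard way to determine the whole graph below: exhibit a nonempty vertex set that
  is closed under taking neighbours.\<close>

lemma closed_eq_V:
  assumes "c \<in> C" "C \<subseteq> V" "\<And>u v. u \<in> C \<Longrightarrow> E u v \<Longrightarrow> v \<in> C"
  shows "C = V"
proof -
  have "x \<in> C" if "x \<in> V" for x
    by (rule graph_connected_induct[OF conn _ _ that, of c]) (use assms in auto)
  with assms show ?thesis by blast
qed

text \<open>Both memberships flip along every edge, so agreement of the two bipartitions at one
  vertex spreads to all. It is needed since an isomorphism with a listed graph brings its own
  bipartition.\<close>

lemma bipartition_unique:
  assumes "bipartite_graph V E A B"
  shows "(A = X \<and> B = Y) \<or> (A = Y \<and> B = X)"
proof -
  interpret AB: connected_bipartite V E A B using assms conn by unfold_locales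
  obtain r where r: "r \<in> V" using conn unfolding graph_connected_def by blast
  have "(x \<in> X \<longleftrightarrow> x \<in> A) \<longleftrightarrow> (r \<in> X \<longleftrightarrow> r \<in> A)" if "x \<in> V" for x
  proof (rule graph_connected_induct[OF conn r _ that])
    fix u v
    assume "E u v" "(u \<in> X \<longleftrightarrow> u \<in> A) \<longleftrightarrow> (r \<in> X \<longleftrightarrow> r \<in> A)"
    then show "(v \<in> X \<longleftrightarrow> v \<in> A) \<longleftrightarrow> (r \<in> X \<longleftrightarrow> r \<in> A)"
      using E_X_iff[of u v] AB.E_X_iff[of u v] by argo
  qed simp
  then have "(\<forall>x\<in>V. x \<in> A \<longleftrightarrow> x \<in> X) \<or> (\<forall>x\<in>V. x \<in> A \<longleftrightarrow> x \<in> Y)"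
    using V_eq disj by blast
  then show ?thesis
  proof
    assume "\<forall>x\<in>V. x \<in> A \<longleftrightarrow> x \<in> X"
    then have "A = X" using V_eq AB.V_eq by blast
    then show ?thesis using V_eq disj AB.V_eq AB.disj by blast
  next
    assume "\<forall>x\<in>V. x \<in> A \<longleftrightarrow> x \<in> Y"
    then have "A = Y" using V_eq AB.V_eq by blast
    then show ?thesis using V_eq disj AB.V_eq AB.disj by blast
  qed
qed

section \<open>Automorphisms of the bipartite graph and the use of homogeneity\<close>

definition aut :: "('a \<Rightarrow> 'a) \<Rightarrow> bool" where
  "aut \<phi> \<longleftrightarrow> bij_betw \<phi> V V \<and> \<phi> ` X = X \<and> \<phi> ` Y = Y \<and>
     (\<forall>x\<in>V. \<forall>y\<in>V. E x y \<longleftrightarrow> E (\<phi> x) (\<phi> y))"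

text \<open>An adjacency-preserving bijection of a connected graph keeps both parts or exchanges
  them, so checking the part of one vertex \<open>r\<close> is enough.\<close>

lemma autI:
  assumes bij: "bij_betw \<phi> V V" and E: "\<And>x y. x \<in> V \<Longrightarrow> y \<in> V \<Longrightarrow> E x y \<longleftrightarrow> E (\<phi> x) (\<phi> y)"
    and r: "r \<in> V" "\<phi> r \<in> X \<longleftrightarrow> r \<in> X"
  shows "aut \<phi>"
proof -
  have side: "\<phi> x \<in> X \<longleftrightarrow> x \<in> X" if "x \<in> V" for x
  proof (rule graph_connected_induct[OF conn r(1) _ that])
    show "\<phi> r \<in> X \<longleftrightarrow> r \<in> X" by (fact r(2))
    show "\<phi> v \<in> X \<longleftrightarrow> v \<in> X" if "u \<in> V" "v \<in> V" "E u v" "\<phi> u \<in> X \<longleftrightarrow> u \<in> X" for u v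
      using E E_X_iff that by blast
  qed
  have im: "\<phi> ` V = V" using bij by (simp add: bij_betw_def)
  \<comment> \<open>\<open>P\<close> is a predicate on truth values: the identity yields the claim
    for \<open>X\<close>, and \<open>Not\<close> yields it for \<open>Y\<close>.\<close>
  have P: "\<phi> ` {x\<in>V. P (x \<in> X)} = {x\<in>V. P (x \<in> X)}" for P
  proof -
    have "{x\<in>V. P (x \<in> X)} = {x \<in> \<phi> ` V. P (x \<in> X)}" using im by simp
    also have "\<dots> = \<phi> ` {x\<in>V. P (x \<in> X)}" using side by (auto simp: image_iff)
    finally show ?thesis by simp
  qed
  have "{x\<in>V. x \<in> X} = X" "{x\<in>V. x \<notin> X} = Y" using V_eq disj by auto
  then have "\<phi> ` X = X" "\<phi> ` Y = Y" using P[of "\<lambda>b. b"] P[of Not] by simp_all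
  with bij E show ?thesis unfolding aut_def by (simp only:) blast
qed

lemma aut_E:
  assumes "aut \<phi>" "E x y" shows "E (\<phi> x) (\<phi> y)"
proof -
  have "\<forall>x\<in>V. \<forall>y\<in>V. E x y \<longleftrightarrow> E (\<phi> x) (\<phi> y)" using assms(1) unfolding aut_def by (elim conjE)
  with assms(2) show ?thesis using E_V[OF assms(2)] by blast
qed

lemma aut_N:
  assumes \<phi>: "aut \<phi>" and v: "v \<in> V" shows "N (\<phi> v) = \<phi> ` N v"
proof -
  have im: "\<phi> ` V = V" using \<phi> by (simp add: aut_def bij_betw_def)
  have iff: "E x y \<longleftrightarrow> E (\<phi> x) (\<phi> y)" if "x \<in> V" "y \<in> V" for x y
    using \<phi> that unfolding aut_def by blast
  have "u \<in> \<phi> ` N v" if vu: "E (\<phi> v) u" for u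
  proof -
    obtain w where "w \<in> V" "u = \<phi> w" using E_V(2)[OF vu] im by (metis imageE)
    then show ?thesis using iff v vu by simp
  qed
  moreover have "E (\<phi> v) (\<phi> u)" if "E v u" for u using aut_E[OF \<phi> that] .
  ultimately show ?thesis by (intro equalityI subsetI) auto
qed

lemma aut_inj: "aut \<phi> \<Longrightarrow> inj_on \<phi> V"
  by (simp add: aut_def bij_betw_def)

lemma N_subset: "N v \<subseteq> V" using E_V by blast

lemma aut_card_Int:
  assumes \<phi>: "aut \<phi>" and "u \<in> V" "v \<in> V"
  shows "card (N (\<phi> u) \<inter> N (\<phi> v)) = card (N u \<inter> N v)"
proof -
  have inj: "inj_on \<phi> (N u \<union> N v)" using aut_inj[OF \<phi>] N_subset by (blast intro: inj_on_subset)
  have "N (\<phi> u) \<inter> N (\<phi> v) = \<phi> ` (N u \<inter> N v)"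
    unfolding aut_N[OF \<phi> assms(2)] aut_N[OF \<phi> assms(3)]
    by (rule inj_on_image_Int[OF inj, symmetric]) auto
  then show ?thesis using inj by (metis (no_types) card_image inj_on_subset inf_le1 le_supI1)
qed

lemma c_homogeneousI:
  assumes ext: "\<And>S f. \<lbrakk>finite S; S \<noteq> {}; S \<subseteq> V; graph_connected S E; inj_on f S; f ` S \<subseteq> V;
      \<And>x y. x \<in> S \<Longrightarrow> y \<in> S \<Longrightarrow> E x y \<longleftrightarrow> E (f x) (f y);
      \<And>x. x \<in> S \<Longrightarrow> f x \<in> X \<longleftrightarrow> x \<in> X\<rbrakk> \<Longrightarrow> \<exists>\<phi>. aut \<phi> \<and> (\<forall>x\<in>S. \<phi> x = f x)"
  shows "c_homogeneous_bipartite V E X Y"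
  unfolding c_homogeneous_bipartite_def graph_connected_induced
proof (intro allI impI, elim conjE)
  fix S f
  assume a: "finite S" "S \<subseteq> V" "graph_connected S E" "inj_on f S" "f ` S \<subseteq> V"
    "\<forall>x\<in>S. \<forall>y\<in>S. E x y = E (f x) (f y)" "f ` (S \<inter> X) \<subseteq> X" "f ` (S \<inter> Y) \<subseteq> Y"
  have "\<exists>\<phi>. aut \<phi> \<and> (\<forall>x\<in>S. \<phi> x = f x)"
  proof (rule ext)
    show "S \<noteq> {}" using a(3) unfolding graph_connected_def by blast
    show "f x \<in> X \<longleftrightarrow> x \<in> X" if "x \<in> S" for x using a(2,7,8) that V_eq disj by blast
  qed (use a in auto)
  then show "\<exists>\<phi>. bij_betw \<phi> V V \<and> \<phi> ` X = X \<and> \<phi> ` Y = Y \<and>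
      (\<forall>x\<in>V. \<forall>y\<in>V. E x y = E (\<phi> x) (\<phi> y)) \<and> (\<forall>x\<in>S. \<phi> x = f x)"
    by (simp only: aut_def conj_assoc)
qed

text \<open>The form in which homogeneity is applied: connectivity of the image is automatic, and
  the condition on the parts is propagated from a single vertex \<open>r\<close> along the edges of
  \<open>S\<close>.\<close>

lemma c_homogeneousD:
  assumes hom: "c_homogeneous_bipartite V E X Y"
    and S: "finite S" "S \<subseteq> V" "graph_connected S E" and f: "inj_on f S" "f ` S \<subseteq> V"
    and E: "\<And>x y. x \<in> S \<Longrightarrow> y \<in> S \<Longrightarrow> E x y \<longleftrightarrow> E (f x) (f y)"
    and r: "r \<in> S" "f r \<in> X \<longleftrightarrow> r \<in> X"
  shows "\<exists>\<phi>. aut \<phi> \<and> (\<forall>x\<in>S. \<phi> x = f x)"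
proof -
  have side: "f x \<in> X \<longleftrightarrow> x \<in> X" if "x \<in> S" for x
  proof (rule graph_connected_induct[OF S(3) r(1) _ that])
    show "f r \<in> X \<longleftrightarrow> r \<in> X" by (fact r(2))
    show "f v \<in> X \<longleftrightarrow> v \<in> X" if "u \<in> S" "v \<in> S" "E u v" "f u \<in> X \<longleftrightarrow> u \<in> X" for u v
      using E E_X_iff that by blast
  qed
  have im: "f ` (S \<inter> X) \<subseteq> X" "f ` (S \<inter> Y) \<subseteq> Y"
    using side f(2) S(2) V_eq disj by blast+
  have "graph_connected (f ` S) E"
    by (rule graph_connected_image[OF S(3)]) (use E in blast)
  then show ?thesis
    using hom[unfolded c_homogeneous_bipartite_def graph_connected_induced, rule_format, of S f]
      S f E im unfolding aut_def by blast
qed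

end

section \<open>The graphs in the list are connected-homogeneous\<close>

text \<open>Domain and image have equally large complements in the finite set \<open>A\<close>;
  these are matched arbitrarily.\<close>

lemma extend_inj_on_to_bij_betw:
  assumes fin: "finite A" and D: "D \<subseteq> A" and f: "inj_on f D" "f ` D \<subseteq> A"
  shows "\<exists>g. bij_betw g A A \<and> (\<forall>x\<in>D. g x = f x)"
proof -
  have finD: "finite D" using fin D finite_subset by blast
  have "card (A - D) = card (A - f ` D)"
    using fin finD D f by (simp add: card_Diff_subset card_image)
  then obtain h where h: "bij_betw h (A - D) (A - f ` D)"
    using finite_same_card_bij[of "A - D" "A - f ` D"] fin by auto
  let ?g = "\<lambda>x. if x \<in> D then f x else h x"
  have "bij_betw ?g D (f ` D)"
    using f(1) by (auto simp: bij_betw_def inj_on_def)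
  moreover have "bij_betw ?g (A - D) (A - f ` D)"
    using h by (rule bij_betw_cong[THEN iffD1, rotated]) auto
  ultimately have "bij_betw ?g (D \<union> (A - D)) (f ` D \<union> (A - f ` D))"
    by (rule bij_betw_combine) auto
  moreover have "D \<union> (A - D) = A" "f ` D \<union> (A - f ` D) = A" using D f(2) by auto
  ultimately show ?thesis by (intro exI[of _ ?g]) auto
qed

section \<open>Complete bipartite graphs and complements of perfect matchings\<close>

context connected_bipartite
begin

lemma c_homogeneous_swap:
  assumes "c_homogeneous_bipartite V E X Y" shows "c_homogeneous_bipartite V E Y X"
  using assms unfolding c_homogeneous_bipartite_def by (simp only: conj_ac)

lemma aut_of_sides:
  assumes \<sigma>: "bij_betw \<sigma> X X" and \<tau>: "bij_betw \<tau> Y Y"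
    and E: "\<And>x y. x \<in> X \<Longrightarrow> y \<in> Y \<Longrightarrow> E x y \<longleftrightarrow> E (\<sigma> x) (\<tau> y)"
  shows "aut (\<lambda>v. if v \<in> X then \<sigma> v else \<tau> v)" (is "aut ?\<phi>")
proof -
  obtain r where r: "r \<in> V" using conn unfolding graph_connected_def by blast
  have X: "bij_betw ?\<phi> X X"
    using \<sigma> by (rule bij_betw_cong[THEN iffD1, rotated]) auto
  have Y: "bij_betw ?\<phi> Y Y"
    using \<tau> by (rule bij_betw_cong[THEN iffD1, rotated]) (use not_XY in auto)
  have bij: "bij_betw ?\<phi> V V"
    unfolding V_eq using X Y disj by (rule bij_betw_combine)
  have \<sigma>X: "\<sigma> x \<in> X" if "x \<in> X" for x using \<sigma> that by (auto simp: bij_betw_def)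
  have \<tau>Y: "\<tau> y \<in> Y" if "y \<in> Y" for y using \<tau> that by (auto simp: bij_betw_def)
  have E1: "E x y \<longleftrightarrow> E (?\<phi> x) (?\<phi> y)" if "x \<in> X" "y \<in> V" for x y
  proof (cases "y \<in> X")
    case True
    then show ?thesis using that not_E_XX \<sigma>X by simp
  next
    case False
    then have "y \<in> Y" using that in_Y_iff by blast
    then show ?thesis using E[of x y] that False by simp
  qed
  have E2: "E x y \<longleftrightarrow> E (?\<phi> x) (?\<phi> y)" if "x \<in> V" "y \<in> V" for x y
  proof (cases "x \<in> X \<or> y \<in> X")
    case True
    then show ?thesis using E1[of x y] E1[of y x] that E_commute by metis
  next
    case False
    then have xy: "x \<in> Y" "y \<in> Y" using that in_Y_iff by auto
    then show ?thesis using False not_E_YY \<tau>Y by simp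
  qed
  have "?\<phi> r \<in> X \<longleftrightarrow> r \<in> X"
    using \<sigma>X \<tau>Y r in_Y_iff not_XY by auto
  from autI[OF bij E2 r this] show ?thesis by blast
qed

text \<open>Every pair of permutations of the two parts is an automorphism, so the restrictions of
  \<open>f\<close> to the parts are extended independently.\<close>

lemma complete_c_homogeneous:
  assumes fin: "finite V" and E: "\<And>x y. x \<in> X \<Longrightarrow> y \<in> Y \<Longrightarrow> E x y"
  shows "c_homogeneous_bipartite V E X Y"
proof (rule c_homogeneousI)
  fix S f
  assume S: "S \<subseteq> V" and f: "inj_on f S" "f ` S \<subseteq> V" and side: "\<And>x. x \<in> S \<Longrightarrow> f x \<in> X \<longleftrightarrow> x \<in> X"
  have finXY: "finite X" "finite Y" using fin V_eq by auto
  have fX: "f ` (S \<inter> X) \<subseteq> X" using side by auto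
  have fY: "f ` (S \<inter> Y) \<subseteq> Y" using side f(2) S in_Y_iff by (auto simp: image_subset_iff subset_iff)
  obtain \<sigma> where \<sigma>: "bij_betw \<sigma> X X" "\<forall>x\<in>S\<inter>X. \<sigma> x = f x"
    using extend_inj_on_to_bij_betw[OF finXY(1) _ inj_on_subset[OF f(1)] fX] by auto
  obtain \<tau> where \<tau>: "bij_betw \<tau> Y Y" "\<forall>x\<in>S\<inter>Y. \<tau> x = f x"
    using extend_inj_on_to_bij_betw[OF finXY(2) _ inj_on_subset[OF f(1)] fY] by auto
  have "aut (\<lambda>v. if v \<in> X then \<sigma> v else \<tau> v)"
    by (rule aut_of_sides[OF \<sigma>(1) \<tau>(1)]) (use E bij_betwE[OF \<sigma>(1)] bij_betwE[OF \<tau>(1)] in auto)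
  moreover have "\<forall>x\<in>S. (if x \<in> X then \<sigma> x else \<tau> x) = f x"
    using \<sigma>(2) \<tau>(2) S in_Y_iff by auto
  ultimately show "\<exists>\<phi>. aut \<phi> \<and> (\<forall>x\<in>S. \<phi> x = f x)" by blast
qed

text \<open>An automorphism moves matched vertices together, so it amounts to a permutation of
  \<open>X\<close>. The map \<open>f\<close> prescribes this permutation at each \<open>x\<close>
  for which \<open>x\<close> or its partner lies in \<open>S\<close>, and the prescriptions form a
  partial injection.\<close>

lemma matching_complement_c_homogeneous:
  assumes fin: "finite V" and \<eta>: "bij_betw \<eta> X Y"
    and E: "\<And>x y. x \<in> X \<Longrightarrow> y \<in> Y \<Longrightarrow> E x y \<longleftrightarrow> y \<noteq> \<eta> x"
  shows "c_homogeneous_bipartite V E X Y"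
proof (rule c_homogeneousI)
  fix S f
  assume S: "S \<subseteq> V" and f: "inj_on f S" "f ` S \<subseteq> V"
    and fE: "\<And>x y. x \<in> S \<Longrightarrow> y \<in> S \<Longrightarrow> E x y \<longleftrightarrow> E (f x) (f y)"
    and side: "\<And>x. x \<in> S \<Longrightarrow> f x \<in> X \<longleftrightarrow> x \<in> X"
  have finX: "finite X" using fin V_eq by auto
  define \<theta> where "\<theta> = inv_into X \<eta>"
  have \<theta>: "bij_betw \<theta> Y X" unfolding \<theta>_def using \<eta> by (rule bij_betw_inv_into)
  have \<eta>\<theta>: "\<eta> (\<theta> y) = y" if "y \<in> Y" for y
    unfolding \<theta>_def using \<eta> that by (simp add: bij_betw_inv_into_right)
  have \<theta>\<eta>: "\<theta> (\<eta> x) = x" if "x \<in> X" for x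
    unfolding \<theta>_def using \<eta> that by (simp add: bij_betw_inv_into_left)
  have \<eta>Y: "\<eta> x \<in> Y" if "x \<in> X" for x using \<eta> that by (auto simp: bij_betw_def)
  have \<theta>X: "\<theta> y \<in> X" if "y \<in> Y" for y using \<theta> that by (auto simp: bij_betw_def)
  have fX: "f x \<in> X" if "x \<in> S" "x \<in> X" for x using side that by auto
  have fY: "f y \<in> Y" if "y \<in> S" "y \<in> Y" for y
    using side[OF that(1)] f(2) that in_Y_iff not_XY by auto
  \<comment> \<open>Vertices of opposite parts are matched exactly when they are not adjacent, and
    \<open>f\<close> preserves non-adjacency. Hence the two ways of reading off the permutation
    agree.\<close>
  have matched: "f (\<eta> x) = \<eta> (f z) \<longleftrightarrow> x = z" if "x \<in> X" "\<eta> x \<in> S" "z \<in> X" "z \<in> S" for x z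
  proof -
    have "f (\<eta> x) \<noteq> \<eta> (f z) \<longleftrightarrow> E (f z) (f (\<eta> x))"
      using E[OF fX fY] that \<eta>Y by simp
    also have "\<dots> \<longleftrightarrow> E z (\<eta> x)" using fE that by simp
    also have "\<dots> \<longleftrightarrow> \<eta> x \<noteq> \<eta> z" using E that \<eta>Y by simp
    also have "\<dots> \<longleftrightarrow> x \<noteq> z" using \<theta>\<eta> that by metis
    finally show ?thesis by blast
  qed
  define D where "D = {x\<in>X. x \<in> S \<or> \<eta> x \<in> S}"
  define g where "g x = (if x \<in> S then f x else \<theta> (f (\<eta> x)))" for x
  have g\<eta>: "\<eta> (g x) = f (\<eta> x)" if "x \<in> X" "\<eta> x \<in> S" for x
    unfolding g_def using matched[of x x] that \<eta>\<theta> fY \<eta>Y by auto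
  have gX: "g ` D \<subseteq> X" unfolding D_def g_def using fX \<theta>X fY \<eta>Y by auto
  have "inj_on g D"
  proof (rule inj_onI)
    fix x z assume D: "x \<in> D" "z \<in> D" and eq: "g x = g z"
    then have X: "x \<in> X" "z \<in> X" unfolding D_def by auto
    consider "x \<in> S" "z \<in> S" | "\<eta> x \<in> S" "\<eta> z \<in> S" | "\<eta> x \<in> S" "z \<in> S" | "x \<in> S" "\<eta> z \<in> S"
      using D unfolding D_def by auto
    then show "x = z"
    proof cases
      case 1
      then show ?thesis using eq f(1) unfolding g_def inj_on_def by auto
    next
      case 2
      then have "f (\<eta> x) = f (\<eta> z)" using g\<eta> X eq by metis
      then have "\<eta> x = \<eta> z" using 2 f(1) unfolding inj_on_def by auto
      then show ?thesis using \<theta>\<eta> X by metis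
    next
      case 3
      have "f (\<eta> x) = \<eta> (f z)" using g\<eta>[OF X(1) 3(1)] eq 3 unfolding g_def by auto
      then show ?thesis using matched X 3 by blast
    next
      case 4
      have "f (\<eta> z) = \<eta> (f x)" using g\<eta>[OF X(2) 4(2)] eq 4 unfolding g_def by auto
      then show ?thesis using matched X 4 by blast
    qed
  qed
  then obtain \<sigma> where \<sigma>: "bij_betw \<sigma> X X" "\<forall>x\<in>D. \<sigma> x = g x"
    using extend_inj_on_to_bij_betw[OF finX, of D g] gX unfolding D_def by auto
  \<comment> \<open>The permutation of \<open>Y\<close> is forced: it is \<open>\<sigma>\<close>
    transported along the matching.\<close>
  define \<tau> where "\<tau> = \<eta> \<circ> (\<sigma> \<circ> \<theta>)"
  have \<tau>: "bij_betw \<tau> Y Y"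
    unfolding \<tau>_def using \<theta> \<sigma>(1) \<eta> by (blast intro: bij_betw_trans)
  have \<sigma>X: "\<sigma> x \<in> X" if "x \<in> X" for x using \<sigma>(1) that by (auto simp: bij_betw_def)
  have "aut (\<lambda>v. if v \<in> X then \<sigma> v else \<tau> v)"
  proof (rule aut_of_sides[OF \<sigma>(1) \<tau>])
    fix x y assume xy: "x \<in> X" "y \<in> Y"
    have "E (\<sigma> x) (\<tau> y) \<longleftrightarrow> \<eta> (\<sigma> (\<theta> y)) \<noteq> \<eta> (\<sigma> x)"
      unfolding \<tau>_def comp_def using E xy \<sigma>X \<theta>X \<eta>Y by simp
    also have "\<dots> \<longleftrightarrow> \<sigma> (\<theta> y) \<noteq> \<sigma> x" using \<theta>\<eta> xy \<sigma>X \<theta>X by metis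
    also have "\<dots> \<longleftrightarrow> \<theta> y \<noteq> x"
      using \<sigma>(1) xy \<theta>X unfolding bij_betw_def inj_on_def by blast
    also have "\<dots> \<longleftrightarrow> y \<noteq> \<eta> x" using \<theta>\<eta> \<eta>\<theta> xy by metis
    finally show "E x y \<longleftrightarrow> E (\<sigma> x) (\<tau> y)" using E xy by simp
  qed
  moreover have "(if x \<in> X then \<sigma> x else \<tau> x) = f x" if "x \<in> S" for x
  proof (cases "x \<in> X")
    case True
    then have "x \<in> D" unfolding D_def using that by simp
    then show ?thesis using True \<sigma>(2) that unfolding g_def by simp
  next
    case False
    then have y: "x \<in> Y" using that S in_Y_iff by auto
    then have "\<theta> x \<in> D" unfolding D_def using \<theta>X \<eta>\<theta> that by simp
    then show ?thesis using False \<sigma>(2) g\<eta>[of "\<theta> x"] \<theta>X y \<eta>\<theta> that unfolding \<tau>_def by simp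
  qed
  ultimately show "\<exists>\<phi>. aut \<phi> \<and> (\<forall>x\<in>S. \<phi> x = f x)" by blast
qed

text \<open>The parts read off from the isomorphism are \<open>X\<close>, \<open>Y\<close> in one of
  the two orders, so homogeneity is shown for both orders.\<close>

lemma Kmn_c_homogeneous:
  assumes "graph_isomorphic V E {0..<m+n} (Kmn_E m n)"
  shows "finite V \<and> c_homogeneous_bipartite V E X Y"
proof -
  obtain h where h: "bij_betw h V {0..<m+n}" "\<And>x y. x \<in> V \<Longrightarrow> y \<in> V \<Longrightarrow> E x y \<longleftrightarrow> Kmn_E m n (h x) (h y)"
    using assms unfolding graph_isomorphic_def graph_iso_def by blast
  have fin: "finite V" using h(1) bij_betw_finite by blast
  have hV: "h v < m + n" if "v \<in> V" for v using h(1) that by (auto simp: bij_betw_def)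
  let ?A = "{v\<in>V. h v < m}" and ?B = "{v\<in>V. \<not> h v < m}"
  have AB: "bipartite_graph V E ?A ?B"
    unfolding bipartite_graph_def
  proof (intro conjI allI impI)
    fix x y assume "E x y"
    then show "x \<in> ?A \<and> y \<in> ?B \<or> x \<in> ?B \<and> y \<in> ?A"
      using h(2)[of x y] E_V[of x y] unfolding Kmn_E_def by auto
  qed (use sym in auto)
  interpret AB: connected_bipartite V E ?A ?B using AB conn by unfold_locales
  have "c_homogeneous_bipartite V E ?A ?B"
    by (rule AB.complete_c_homogeneous[OF fin]) (use h(2) hV in \<open>auto simp: Kmn_E_def\<close>)
  then have "c_homogeneous_bipartite V E ?A ?B" "c_homogeneous_bipartite V E ?B ?A"
    using AB.c_homogeneous_swap by blast+
  then show ?thesis using fin bipartition_unique[OF AB] by (elim disjE conjE) (simp_all only:)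
qed

lemma cpm_c_homogeneous:
  assumes "graph_isomorphic V E {0..<2*n} (cpm_E n)"
  shows "finite V \<and> c_homogeneous_bipartite V E X Y"
proof -
  obtain h where h: "bij_betw h V {0..<2*n}" "\<And>x y. x \<in> V \<Longrightarrow> y \<in> V \<Longrightarrow> E x y \<longleftrightarrow> cpm_E n (h x) (h y)"
    using assms unfolding graph_isomorphic_def graph_iso_def by blast
  have fin: "finite V" using h(1) bij_betw_finite by blast
  have hV: "h v < 2 * n" if "v \<in> V" for v using h(1) that by (auto simp: bij_betw_def)
  let ?A = "{v\<in>V. h v < n}" and ?B = "{v\<in>V. \<not> h v < n}"
  have AB: "bipartite_graph V E ?A ?B"
    unfolding bipartite_graph_def
  proof (intro conjI allI impI)
    fix x y assume "E x y"
    then show "x \<in> ?A \<and> y \<in> ?B \<or> x \<in> ?B \<and> y \<in> ?A"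
      using h(2)[of x y] E_V[of x y] unfolding cpm_E_def by auto
  qed (use sym in auto)
  interpret AB: connected_bipartite V E ?A ?B using AB conn by unfold_locales
  define g where "g = inv_into V h"
  have hg: "h (g i) = i" and gV: "g i \<in> V" if "i < 2 * n" for i
    using h(1) that unfolding g_def bij_betw_def by (auto intro: f_inv_into_f inv_into_into)
  have gh: "g (h v) = v" if "v \<in> V" for v
    using h(1) that unfolding g_def by (simp add: bij_betw_inv_into_left)
  define \<eta> where "\<eta> v = g (n + h v)" for v
  have \<eta>: "\<eta> v \<in> V" "h (\<eta> v) = n + h v" if "h v < n" for v
    unfolding \<eta>_def using hg gV that by auto
  have "bij_betw \<eta> ?A ?B"
  proof (rule bij_betw_byWitness[where f' = "\<lambda>v. g (h v - n)"])
    show "\<forall>v\<in>?A. g (h (\<eta> v) - n) = v" using \<eta> gh by simp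
    show "\<forall>v\<in>?B. \<eta> (g (h v - n)) = v"
    proof
      fix v assume v: "v \<in> ?B"
      then have "h v - n < 2 * n" "n + (h v - n) = h v" using hV[of v] by auto
      then show "\<eta> (g (h v - n)) = v" unfolding \<eta>_def using hg gh v by simp
    qed
    show "\<eta> ` ?A \<subseteq> ?B" using \<eta> by auto
    show "(\<lambda>v. g (h v - n)) ` ?B \<subseteq> ?A"
    proof
      fix w assume "w \<in> (\<lambda>v. g (h v - n)) ` ?B"
      then obtain v where v: "v \<in> V" "\<not> h v < n" "w = g (h v - n)" by auto
      then have "h v - n < 2 * n" "h v - n < n" using hV[of v] by auto
      then show "w \<in> ?A" using hg gV v by auto
    qed
  qed
  then have "c_homogeneous_bipartite V E ?A ?B"
  proof (rule AB.matching_complement_c_homogeneous[OF fin])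
    fix x y assume xy: "x \<in> ?A" "y \<in> ?B"
    have "h y \<noteq> n + h x \<longleftrightarrow> y \<noteq> \<eta> x"
      using xy \<eta>[of x] gh[of y] unfolding \<eta>_def by auto
    then show "E x y \<longleftrightarrow> y \<noteq> \<eta> x"
      using h(2)[of x y] xy hV[of y] unfolding cpm_E_def by auto
  qed
  then have "c_homogeneous_bipartite V E ?A ?B" "c_homogeneous_bipartite V E ?B ?A"
    using AB.c_homogeneous_swap by blast+
  then show ?thesis using fin bipartition_unique[OF AB] by (elim disjE conjE) (simp_all only:)
qed

end

section \<open>Even cycles\<close>

context connected_bipartite
begin

text \<open>Where each vertex has at most two neighbours, the images of two adjacent vertices
  determine a partial isomorphism on a connected set. It therefore suffices to move any arc to any
  other arc that starts in the same part.\<close>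

lemma dihedral_c_homogeneous:
  assumes deg: "\<And>v u1 u2 u3. E v u1 \<Longrightarrow> E v u2 \<Longrightarrow> E v u3 \<Longrightarrow> u1 = u2 \<or> u1 = u3 \<or> u2 = u3"
    and arc: "\<And>u v u' v'. E u v \<Longrightarrow> E u' v' \<Longrightarrow> (u \<in> X \<longleftrightarrow> u' \<in> X) \<Longrightarrow>
        \<exists>\<phi>. aut \<phi> \<and> \<phi> u = u' \<and> \<phi> v = v'"
    and ne: "\<And>v. v \<in> V \<Longrightarrow> \<exists>u. E v u"
  shows "c_homogeneous_bipartite V E X Y"
proof (rule c_homogeneousI)
  fix S f
  assume S: "S \<noteq> {}" "S \<subseteq> V" "graph_connected S E" and f: "inj_on f S" "f ` S \<subseteq> V"
    and fE: "\<And>x y. x \<in> S \<Longrightarrow> y \<in> S \<Longrightarrow> E x y \<longleftrightarrow> E (f x) (f y)"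
    and side: "\<And>x. x \<in> S \<Longrightarrow> f x \<in> X \<longleftrightarrow> x \<in> X"
  obtain u where u: "u \<in> S" using S(1) by blast
  show "\<exists>\<phi>. aut \<phi> \<and> (\<forall>x\<in>S. \<phi> x = f x)"
  proof (cases "S = {u}")
    case True
    have "u \<in> V" "f u \<in> V" using u S(2) f(2) by auto
    then obtain v v' where "E u v" "E (f u) v'" using ne by meson
    from arc[OF this] side[OF u] True show ?thesis by auto
  next
    case False
    then obtain v where v: "v \<in> S" "E u v" using graph_connected_ex_neighbour[OF S(3) u] by blast
    then obtain \<phi> where \<phi>: "aut \<phi>" "\<phi> u = f u" "\<phi> v = f v"
      using arc[OF v(2), of "f u" "f v"] fE[OF u v(1)] side[OF u] by blast
    have inj: "\<phi> x = \<phi> y \<longleftrightarrow> x = y" if "x \<in> V" "y \<in> V" for x y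
      using aut_inj[OF \<phi>(1)] that by (auto simp: inj_on_def)
    \<comment> \<open>For \<open>t\<close> other than \<open>w\<close>, both \<open>f t\<close> and
      \<open>\<phi> t\<close> are neighbours of \<open>f s\<close> different from
      \<open>f w\<close>, and only one such neighbour exists.\<close>
    have fixed: "\<phi> t = f t" if s: "s \<in> S" "\<phi> s = f s" and w: "w \<in> S" "E s w" "\<phi> w = f w"
      and t: "t \<in> S" "E s t" for s w t
    proof (cases "t = w")
      case False
      have "E (f s) (f w)" "E (f s) (f t)" using fE s w t by blast+
      moreover have "E (f s) (\<phi> t)" using aut_E[OF \<phi>(1) t(2)] s by simp
      moreover have "f w \<noteq> f t" using False f(1) w t by (auto simp: inj_on_def)
      moreover have "f w \<noteq> \<phi> t" using inj[of w t] False w t S(2) by auto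
      ultimately show ?thesis using deg by metis
    qed (use w in simp)
    have "\<phi> x = f x \<and> (\<forall>t\<in>S. E x t \<longrightarrow> \<phi> t = f t)" if "x \<in> S" for x
    proof (rule graph_connected_induct[OF S(3) u _ that])
      show "\<phi> u = f u \<and> (\<forall>t\<in>S. E u t \<longrightarrow> \<phi> t = f t)" using fixed[OF u \<phi>(2) v \<phi>(3)] \<phi>(2) by blast
      show "\<phi> t = f t \<and> (\<forall>t'\<in>S. E t t' \<longrightarrow> \<phi> t' = f t')"
        if "s \<in> S" "t \<in> S" "E s t" "\<phi> s = f s \<and> (\<forall>t\<in>S. E s t \<longrightarrow> \<phi> t = f t)" for s t
        using that fixed[of t s] sym by blast
    qed
    with \<phi>(1) show ?thesis by blast
  qed
qed

lemma cycle_c_homogeneous: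
  assumes m: "m \<ge> 4" and iso: "graph_isomorphic V E {0..<m} (cycle_E m)"
  shows "finite V \<and> c_homogeneous_bipartite V E X Y"
proof -
  obtain h where h: "bij_betw h V {0..<m}" "\<And>x y. x \<in> V \<Longrightarrow> y \<in> V \<Longrightarrow> E x y \<longleftrightarrow> cycle_E m (h x) (h y)"
    using iso unfolding graph_isomorphic_def graph_iso_def by blast
  have fin: "finite V" using h(1) bij_betw_finite by blast
  have hV: "h v < m" if "v \<in> V" for v using h(1) that by (auto simp: bij_betw_def)
  define g where "g = inv_into V h"
  have hg: "h (g i) = i" and gV: "g i \<in> V" if "i < m" for i
    using h(1) that unfolding g_def bij_betw_def by (auto intro: f_inv_into_f inv_into_into)
  have gh: "g (h v) = v" if "v \<in> V" for v
    using h(1) that unfolding g_def by (simp add: bij_betw_inv_into_left)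
  define M where "M = int m"
  have M: "M \<ge> 4" unfolding M_def using m by simp
  \<comment> \<open>Vertices are numbered periodically by all integers, so that rotations and
    reflections become affine maps and adjacency becomes a divisibility statement.\<close>
  define p where "p i = g (nat (i mod M))" for i :: int
  have nat_lt: "nat (i mod M) < m" for i
    using M pos_mod_bound[of M i] by (auto simp: M_def nat_less_iff)
  have pV: "p i \<in> V" for i unfolding p_def using gV nat_lt by blast
  have hp: "int (h (p i)) = i mod M" for i
    unfolding p_def using hg nat_lt M by simp
  have p_surj: "p (int (h v)) = v" if "v \<in> V" for v
    unfolding p_def using hV[OF that] gh[OF that] by (simp add: M_def)
  have p_eq: "p i = p j \<longleftrightarrow> M dvd i - j" for i j
  proof -
    have "p i = p j \<longleftrightarrow> int (h (p i)) = int (h (p j))" using gh pV by (metis of_nat_eq_iff)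
    then show ?thesis by (simp add: hp mod_eq_dvd_iff)
  qed
  have p_E: "E (p i) (p j) \<longleftrightarrow> M dvd j - i - 1 \<or> M dvd i - j - 1" for i j
  proof -
    have *: "h (p b) = (h (p a) + 1) mod m \<longleftrightarrow> M dvd b - a - 1" for a b
    proof -
      have "h (p b) = (h (p a) + 1) mod m \<longleftrightarrow> int (h (p b)) = int ((h (p a) + 1) mod m)"
        by (simp only: of_nat_eq_iff)
      also have "int ((h (p a) + 1) mod m) = (a + 1) mod M"
        by (simp add: zmod_int hp M_def[symmetric] mod_simps add.commute)
      finally show ?thesis by (simp add: hp mod_eq_dvd_iff algebra_simps)
    qed
    have "E (p i) (p j) \<longleftrightarrow> cycle_E m (h (p i)) (h (p j))" by (rule h(2)[OF pV pV])
    then show ?thesis unfolding cycle_E_def * using hV[OF pV] by simp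
  qed
  have step: "\<exists>i d. u = p i \<and> v = p (i + d) \<and> (d = 1 \<or> d = - 1)" if "E u v" for u v
  proof -
    define i j where "i = int (h u)" and "j = int (h v)"
    have uv: "u = p i" "v = p j" unfolding i_def j_def using p_surj E_V[OF that] by auto
    then have "M dvd j - i - 1 \<or> M dvd i - j - 1" using p_E that by blast
    then have "v = p (i + 1) \<or> v = p (i + - 1)"
    proof
      assume "M dvd j - i - 1"
      then have "p j = p (i + 1)" unfolding p_eq by (simp add: algebra_simps)
      then show ?thesis using uv by simp
    next
      assume "M dvd i - j - 1"
      then have "p (i + - 1) = p j" unfolding p_eq by (simp add: algebra_simps)
      then show ?thesis using uv by simp
    qed
    with uv show ?thesis by blast
  qed
  have "c_homogeneous_bipartite V E X Y"
  proof (rule dihedral_c_homogeneous)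
    fix v u1 u2 u3 assume E: "E v u1" "E v u2" "E v u3"
    define i where "i = int (h v)"
    have v: "v = p i" unfolding i_def using p_surj E_V[OF E(1)] by simp
    have "u = p (i + 1) \<or> u = p (i - 1)" if vu: "E v u" for u
    proof -
      obtain j d where jd: "v = p j" "u = p (j + d)" "d = 1 \<or> d = - 1" using step[OF vu] by blast
      have "p j = p i" using jd(1) v by simp
      then have "M dvd (j + d) - (i + d)" unfolding p_eq by simp
      then have "u = p (i + d)" using jd(2) p_eq by blast
      with jd(3) show ?thesis by auto
    qed
    then show "u1 = u2 \<or> u1 = u3 \<or> u2 = u3" using E by metis
  next
    fix v assume "v \<in> V"
    then have "E v (p (int (h v) + 1))" using p_E[of "int (h v)" "int (h v) + 1"] p_surj by simp
    then show "\<exists>u. E v u" by blast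
  next
    fix u v u' v' assume E: "E u v" "E u' v'" and side: "u \<in> X \<longleftrightarrow> u' \<in> X"
    obtain i d where i: "u = p i" "v = p (i + d)" "d = 1 \<or> d = - 1" using step[OF E(1)] by blast
    obtain i' d' where i': "u' = p i'" "v' = p (i' + d')" "d' = 1 \<or> d' = - 1" using step[OF E(2)] by blast
    \<comment> \<open>The sign \<open>D\<close> selects a rotation or a reflection. As
      \<open>d\<close> is a sign, \<open>D * d = d'\<close>, so the affine map taking
      \<open>i\<close> to \<open>i'\<close> also matches the directions of the arcs.\<close>
    define D where "D = d * d'"
    have D: "D = 1 \<or> D = - 1" using i i' unfolding D_def by auto
    define \<phi> where "\<phi> v = p (i' + D * (int (h v) - i))" for v
    have \<phi>p: "\<phi> (p j) = p (i' + D * (j - i))" for j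
    proof -
      have "M dvd int (h (p j)) - j" unfolding hp by (simp add: mod_eq_dvd_iff[symmetric])
      then have "M dvd D * (int (h (p j)) - j)" by simp
      then show ?thesis unfolding \<phi>_def p_eq by (simp add: algebra_simps)
    qed
    have "\<phi> (p j) = \<phi> (p k) \<longleftrightarrow> p j = p k" for j k
    proof -
      have eq: "i' + D * (j - i) - (i' + D * (k - i)) = D * (j - k)" by (simp add: algebra_simps)
      have "M dvd D * (j - k) \<longleftrightarrow> M dvd j - k" using D dvd_minus_iff[of M "j - k"] by fastforce
      then show ?thesis unfolding \<phi>p p_eq eq .
    qed
    then have "inj_on \<phi> V" unfolding inj_on_def using p_surj by metis
    moreover have "\<phi> ` V \<subseteq> V" unfolding \<phi>_def using pV by auto
    ultimately have bij: "bij_betw \<phi> V V" using fin by (simp add: bij_betw_def endo_inj_surj)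
    have "E (p j) (p k) \<longleftrightarrow> E (\<phi> (p j)) (\<phi> (p k))" for j k
      unfolding \<phi>p p_E using D by (auto simp: algebra_simps)
    then have \<phi>E: "E x y \<longleftrightarrow> E (\<phi> x) (\<phi> y)" if "x \<in> V" "y \<in> V" for x y
      using p_surj that by metis
    have "\<phi> u = u'" using \<phi>p[of i] i i' by simp
    moreover have "\<phi> v = v'"
    proof -
      have "D * d = d'" using i(3) unfolding D_def by auto
      then show ?thesis using \<phi>p[of "i + d"] i i' by simp
    qed
    moreover have "aut \<phi>"
      by (rule autI[OF bij \<phi>E, of u]) (use E_V[OF E(1)] side \<open>\<phi> u = u'\<close> in auto)
    ultimately show "\<exists>\<phi>. aut \<phi> \<and> \<phi> u = u' \<and> \<phi> v = v'" by blast
  qed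
  with fin show ?thesis by blast
qed

end

section \<open>Semiregular trees\<close>

context connected_bipartite
begin

text \<open>A partial isomorphism is kept as its graph, a set of pairs; by Zorn's lemma there is a
  maximal one among those with connected domain, and in a semiregular tree a domain that misses
  a neighbour of one of its vertices can be enlarged.\<close>

lemma tree_c_homogeneous:
  assumes ac: "graph_acyclic V E"
    and degX: "\<And>x. x \<in> X \<Longrightarrow> finite (N x) \<and> card (N x) = a"
    and degY: "\<And>y. y \<in> Y \<Longrightarrow> finite (N y) \<and> card (N y) = b"
  shows "c_homogeneous_bipartite V E X Y"
proof (rule c_homogeneousI)
  fix S f
  assume S: "S \<noteq> {}" "S \<subseteq> V" "graph_connected S E" and f: "inj_on f S" "f ` S \<subseteq> V"
    and fE: "\<And>x y. x \<in> S \<Longrightarrow> y \<in> S \<Longrightarrow> E x y \<longleftrightarrow> E (f x) (f y)"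
    and side: "\<And>x. x \<in> S \<Longrightarrow> f x \<in> X \<longleftrightarrow> x \<in> X"
  define F where "F = (\<lambda>s. (s, f s)) ` S"
  define E2 where "E2 = (\<lambda>(p :: 'a \<times> 'a) (q :: 'a \<times> 'a). E (fst p) (fst q))"
  \<comment> \<open>A set of pairwise compatible pairs is the graph of a partial isomorphism:
    single-valued, injective, preserving adjacency both ways and preserving the parts. Being a
    condition on two pairs, it survives unions of chains.\<close>
  define compat where "compat p q \<longleftrightarrow> (fst p = fst q \<longleftrightarrow> snd p = snd q) \<and>
      (E (fst p) (fst q) \<longleftrightarrow> E (snd p) (snd q)) \<and> (fst p \<in> X \<longleftrightarrow> snd p \<in> X)" for p q
  define \<A> where "\<A> = {R. F \<subseteq> R \<and> R \<subseteq> V \<times> V \<and> (\<forall>p\<in>R. \<forall>q\<in>R. compat p q) \<and> graph_connected R E2}"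
  obtain r where r: "r \<in> S" using S(1) by blast
  have "\<exists>M\<in>\<A>. \<forall>R\<in>\<A>. M \<subseteq> R \<longrightarrow> R = M"
  proof (rule subset_Zorn_nonempty)
    have "graph_connected F E2" unfolding F_def
      by (rule graph_connected_image[OF S(3)]) (simp add: E2_def)
    moreover have "\<forall>p\<in>F. \<forall>q\<in>F. compat p q"
      unfolding F_def compat_def using fE side f(1) by (auto simp: inj_on_def)
    moreover have "F \<subseteq> V \<times> V" unfolding F_def using S(2) f(2) by auto
    ultimately show "\<A> \<noteq> {}" unfolding \<A>_def by blast
  next
    fix C assume C: "C \<noteq> {}" "subset.chain \<A> C"
    have sub: "R \<in> \<A>" if "R \<in> C" for R using C(2) that by (auto simp: subset.chain_def)
    have rF: "(r, f r) \<in> F" unfolding F_def using r by blast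
    have "graph_connected (\<Union>C) E2"
    proof (rule graph_connected_Union[OF C(1)])
      show "graph_connected R E2" "(r, f r) \<in> R" if "R \<in> C" for R
        using sub[OF that] rF unfolding \<A>_def by blast+
    qed
    moreover have "compat p q" if "p \<in> \<Union>C" "q \<in> \<Union>C" for p q
    proof -
      from that obtain R R' where R: "R \<in> C" "R' \<in> C" "p \<in> R" "q \<in> R'" by blast
      then have "R \<subseteq> R' \<or> R' \<subseteq> R" using C(2) by (auto simp: subset.chain_def)
      then obtain T where "T \<in> C" "p \<in> T" "q \<in> T" using R by blast
      then show ?thesis using sub[of T] unfolding \<A>_def by blast
    qed
    moreover have "F \<subseteq> \<Union>C" "\<Union>C \<subseteq> V \<times> V" using sub C(1) unfolding \<A>_def by blast+
    ultimately show "\<Union>C \<in> \<A>" unfolding \<A>_def by blast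
  qed
  then obtain M where M: "M \<in> \<A>" and maxM: "\<And>R. R \<in> \<A> \<Longrightarrow> M \<subseteq> R \<Longrightarrow> R = M" by blast
  have FM: "F \<subseteq> M" and MV: "M \<subseteq> V \<times> V" and conM: "graph_connected M E2"
    and comp: "\<And>p q. p \<in> M \<Longrightarrow> q \<in> M \<Longrightarrow> compat p q"
    using M unfolding \<A>_def by auto
  have eqM: "fst p = fst q \<longleftrightarrow> snd p = snd q" and EM: "E (fst p) (fst q) \<longleftrightarrow> E (snd p) (snd q)"
    and sideM: "fst p \<in> X \<longleftrightarrow> snd p \<in> X" if "p \<in> M" "q \<in> M" for p q
    using comp[OF that] unfolding compat_def by blast+
  have rM: "(r, f r) \<in> M" using FM r unfolding F_def by auto
  have sub1: "fst ` M \<subseteq> V" and sub2: "snd ` M \<subseteq> V" using MV by auto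
  have con1: "graph_connected (fst ` M) E"
    by (rule graph_connected_image[OF conM]) (simp add: E2_def)
  have con2: "graph_connected (snd ` M) E"
    by (rule graph_connected_image[OF conM]) (use EM in \<open>simp add: E2_def\<close>)
  have finN: "finite (N v)" if "v \<in> V" for v using that degX degY in_Y_iff by blast
  have deg: "card (N u) = card (N u')" if "(u, u') \<in> M" for u u'
  proof -
    have "u \<in> X \<longleftrightarrow> u' \<in> X" "u \<in> V" "u' \<in> V" using sideM[OF that that] that MV by auto
    then show ?thesis using degX degY in_Y_iff by metis
  qed
  \<comment> \<open>Both sides count the same pairs of \<open>M\<close>. Since \<open>u\<close> and
    \<open>u'\<close> have equal finite degree, a neighbour of \<open>u\<close> outside the domain
    entails a neighbour of \<open>u'\<close> outside the range, and conversely.\<close>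
  have cards: "card (N u \<inter> fst ` M) = card (N u' \<inter> snd ` M)" if "(u, u') \<in> M" for u u'
  proof -
    let ?T = "{p\<in>M. E u (fst p)}"
    have "fst ` ?T = N u \<inter> fst ` M" by auto
    moreover have "snd ` ?T = N u' \<inter> snd ` M" using EM[OF that] by auto
    moreover have "inj_on fst ?T" "inj_on snd ?T" using eqM by (auto simp: inj_on_def prod_eq_iff)
    ultimately show ?thesis by (metis card_image)
  qed
  have dom: "fst ` M = V"
  proof (rule closed_eq_V)
    show "r \<in> fst ` M" using rM by force
    show "fst ` M \<subseteq> V" by (fact sub1)
    fix u v assume u: "u \<in> fst ` M" and uv: "E u v"
    show "v \<in> fst ` M"
    proof (rule ccontr)
      assume v: "v \<notin> fst ` M"
      obtain u' where u': "(u, u') \<in> M" using u by auto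
      then have uV: "u \<in> V" "u' \<in> V" using MV by auto
      have "card (N u \<inter> fst ` M) < card (N u)"
        by (rule psubset_card_mono[OF finN[OF uV(1)]]) (use v uv in auto)
      then have "N u' \<inter> snd ` M \<noteq> N u'" using cards[OF u'] deg[OF u'] by auto
      then obtain w where w: "E u' w" "w \<notin> snd ` M" by auto
      let ?R = "insert (v, w) M"
      have vw: "v \<in> V" "w \<in> V" using E_V uv w(1) by blast+
      \<comment> \<open>Acyclicity makes \<open>u\<close> the only neighbour of \<open>v\<close> in
        the connected domain, and likewise \<open>u'\<close> the only neighbour of \<open>w\<close>
        in the range; so adding the pair respects all adjacencies.\<close>
      have Ev: "E v (fst p) \<longleftrightarrow> fst p = u" if "p \<in> M" for p
        using graph_acyclic_unique_neighbour[OF ac con1 sub1 vw(1) v _ u, of "fst p"] uv sym that by blast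
      have Ew: "E w (snd p) \<longleftrightarrow> snd p = u'" if "p \<in> M" for p
      proof -
        have "u' \<in> snd ` M" using u' by force
        then show ?thesis
          using graph_acyclic_unique_neighbour[OF ac con2 sub2 vw(2) w(2) _ _, of "snd p" u'] w(1) sym that
          by blast
      qed
      have sd: "v \<in> X \<longleftrightarrow> w \<in> X" using E_X_iff[OF uv] E_X_iff[OF w(1)] sideM[OF u' u'] by auto
      have new: "compat (v, w) p" "compat p (v, w)" if "p \<in> M" for p
      proof -
        have "fst p \<noteq> v" "snd p \<noteq> w" using that v w by auto
        moreover have "E v (fst p) \<longleftrightarrow> E w (snd p)"
          using Ev[OF that] Ew[OF that] eqM[OF that u'] by simp
        ultimately show "compat (v, w) p" "compat p (v, w)"
          unfolding compat_def using sd sideM[OF that that] E_commute by auto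
      qed
      have self: "compat (v, w) (v, w)" unfolding compat_def using sd not_E_refl by auto
      have "graph_connected ?R E2"
        by (rule graph_connected_insert[OF conM u']) (use uv sym in \<open>auto simp: E2_def\<close>)
      then have "?R \<in> \<A>" unfolding \<A>_def using FM MV vw comp new self by auto
      from maxM[OF this] have "(v, w) \<in> M" by auto
      then show False using v by force
    qed
  qed
  have ran: "snd ` M = V"
  proof (rule closed_eq_V)
    show "f r \<in> snd ` M" using rM by force
    show "snd ` M \<subseteq> V" by (fact sub2)
    fix u' w assume "u' \<in> snd ` M" and uw: "E u' w"
    then obtain u where u: "(u, u') \<in> M" by auto
    have "N u \<inter> fst ` M = N u" using dom N_subset by auto
    then have "card (N u' \<inter> snd ` M) = card (N u')" using cards[OF u] deg[OF u] by simp
    moreover have "finite (N u')" using finN u MV by auto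
    ultimately have "N u' \<inter> snd ` M = N u'" by (intro card_subset_eq) auto
    then show "w \<in> snd ` M" using uw by auto
  qed
  have "\<forall>v\<in>V. \<exists>w. (v, w) \<in> M" using dom by force
  then obtain \<phi> where \<phi>: "\<And>v. v \<in> V \<Longrightarrow> (v, \<phi> v) \<in> M" by metis
  have \<phi>_eq: "\<phi> v = w" if "(v, w) \<in> M" for v w
    using eqM[OF that \<phi>[of v]] that MV by auto
  have "bij_betw \<phi> V V"
    unfolding bij_betw_def
  proof
    show "inj_on \<phi> V"
    proof (rule inj_onI)
      fix x y assume "x \<in> V" "y \<in> V" "\<phi> x = \<phi> y"
      then show "x = y" using eqM[OF \<phi>[of x] \<phi>[of y]] by simp
    qed
    show "\<phi> ` V = V"
    proof
      show "\<phi> ` V \<subseteq> V" using \<phi> MV by auto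
      show "V \<subseteq> \<phi> ` V"
      proof
        fix w assume "w \<in> V"
        then obtain v where "(v, w) \<in> M" using ran by force
        then show "w \<in> \<phi> ` V" using \<phi>_eq MV by blast
      qed
    qed
  qed
  moreover have "E x y \<longleftrightarrow> E (\<phi> x) (\<phi> y)" if "x \<in> V" "y \<in> V" for x y
    using EM[OF \<phi>[OF that(1)] \<phi>[OF that(2)]] by simp
  moreover have "r \<in> V" using r S(2) by auto
  moreover have "\<phi> r \<in> X \<longleftrightarrow> r \<in> X" using sideM[OF rM rM] \<phi>_eq[OF rM] by simp
  ultimately have "aut \<phi>" by (rule autI)
  moreover have "\<forall>x\<in>S. \<phi> x = f x" using \<phi>_eq FM unfolding F_def by auto
  ultimately show "\<exists>\<phi>. aut \<phi> \<and> (\<forall>x\<in>S. \<phi> x = f x)" by blast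
qed

end

section \<open>Extending partial isomorphisms\<close>

lemma graph_connected_star:
  assumes "finite A" "\<And>y. y \<in> A \<Longrightarrow> E x y \<and> E y x"
  shows "graph_connected (insert x A) E"
  using assms
proof (induction A)
  case empty
  show ?case by (rule graph_connected_singleton)
next
  case (insert y A)
  then have "graph_connected (insert y (insert x A)) E"
    by (intro graph_connected_insert[of "insert x A" E x y]) auto
  then show ?case by (simp add: insert_commute)
qed

lemma graph_connected_path:
  assumes sym: "\<And>u v. E u v \<Longrightarrow> E v u" and "ps \<noteq> []" "successively E ps"
  shows "graph_connected (set ps) E"
  using assms(2,3)
proof (induction ps rule: rev_induct)
  case (snoc v ps)
  show ?case
  proof (cases "ps = []")
    case True
    then show ?thesis by (simp add: graph_connected_singleton)
  next
    case False
    with snoc have "graph_connected (set ps) E" "E (last ps) v"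
      by (auto simp: successively_append_iff)
    then have "graph_connected (insert v (set ps)) E"
      using False sym by (intro graph_connected_insert[of _ _ "last ps"]) auto
    then show ?thesis by simp
  qed
qed simp

text \<open>A chord would close a segment of the path to a cycle with at most
  \<open>length ps\<close> vertices.\<close>

lemma path_induced_of_long_cycles:
  assumes sym: "\<And>u v. E u v \<Longrightarrow> E v u" and irr: "\<And>u. \<not> E u u"
    and long: "\<And>cs. cycle_list E cs \<Longrightarrow> length cs > length ps"
    and ps: "distinct ps" "successively E ps" and ij: "i < length ps" "j < length ps"
  shows "E (ps ! i) (ps ! j) \<longleftrightarrow> j = i + 1 \<or> i = j + 1"
proof -
  have chord: "q = p + 1" if "p < q" "q < length ps" "E (ps ! p) (ps ! q)" for p q
  proof (rule ccontr)
    assume "q \<noteq> p + 1"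
    define cs where "cs = take (q - p + 1) (drop p ps)"
    have len: "length cs = q - p + 1" unfolding cs_def using that by simp
    have nth: "cs ! k = ps ! (p + k)" if "k < length cs" for k
      using that \<open>p < q\<close> \<open>q < length ps\<close> unfolding cs_def by simp
    have "cs \<noteq> []" using len by auto
    then have "hd cs = ps ! p" "last cs = ps ! q"
      using nth[of 0] nth[of "q - p"] len that by (auto simp: hd_conv_nth last_conv_nth)
    moreover have "successively E cs"
      using ps(2) len that nth by (auto simp: successively_conv_nth)
    moreover have "distinct cs" unfolding cs_def using ps(1) by simp
    moreover have "length cs \<ge> 3" using len that \<open>q \<noteq> p + 1\<close> by simp
    ultimately have "cycle_list E cs" unfolding cycle_list_def using that sym by auto
    from long[OF this] show False using len that by simp
  qed
  have "E (ps ! i) (ps ! j)" if "j = i + 1 \<or> i = j + 1"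
    using that ps(2) ij sym by (auto simp: successively_conv_nth)
  moreover have "j = i + 1 \<or> i = j + 1" if "E (ps ! i) (ps ! j)"
    using chord[of i j] chord[of j i] that sym irr ij by (metis linorder_neqE_nat)
  ultimately show ?thesis by blast
qed

locale homogeneous_bipartite = connected_bipartite +
  assumes lf: "locally_finite V E" and hom: "c_homogeneous_bipartite V E X Y"
begin

lemma homogeneous_swap: "homogeneous_bipartite V E Y X"
  unfolding homogeneous_bipartite_def homogeneous_bipartite_axioms_def
  using swap lf c_homogeneous_swap[OF hom] by blast

lemma finite_N: "finite (N v)"
proof (cases "v \<in> V")
  case True
  then show ?thesis using lf neighbours_eq[of v] unfolding locally_finite_def by auto
next
  case False
  then have "N v = {}" using E_V by auto
  then show ?thesis by simp
qed

lemmas extend = c_homogeneousD[OF hom]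

lemma card_N_eq:
  assumes "u \<in> V" "v \<in> V" "u \<in> X \<longleftrightarrow> v \<in> X" shows "card (N u) = card (N v)"
proof -
  have "\<exists>\<phi>. aut \<phi> \<and> (\<forall>x\<in>{u}. \<phi> x = (\<lambda>_. v) x)"
    by (rule extend[where r = u]) (use assms not_E_refl graph_connected_singleton in auto)
  then obtain \<phi> where "aut \<phi>" "\<phi> u = v" by auto
  then show ?thesis using aut_card_Int[of \<phi> u u] assms by simp
qed

text \<open>The ends of a path with three vertices lie in the same part, so the path is induced, and
  homogeneity moves it to any other with its middle in the same part.\<close>

lemma extend_cherry:
  assumes E: "E y x" "E y x'" "E w z" "E w z'" and ne: "x \<noteq> x'" "z \<noteq> z'" and side: "y \<in> X \<longleftrightarrow> w \<in> X"
  shows "\<exists>\<phi>. aut \<phi> \<and> \<phi> x = z \<and> \<phi> x' = z' \<and> \<phi> y = w"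
proof -
  let ?f = "\<lambda>v. if v = x then z else if v = x' then z' else w"
  have xy: "y \<noteq> x" "y \<noteq> x'" "w \<noteq> z" "w \<noteq> z'" using E not_E_refl by auto
  have nE: "\<not> E x x'" "\<not> E x' x" "\<not> E z z'" "\<not> E z' z"
    using E E_X_iff by blast+
  have "graph_connected (insert y {x, x'}) E"
    by (rule graph_connected_star) (use E sym in auto)
  moreover have "E u v \<longleftrightarrow> E (?f u) (?f v)" if "u \<in> {y, x, x'}" "v \<in> {y, x, x'}" for u v
    using that E E[THEN sym] ne xy nE not_E_refl by auto
  moreover have "{y, x, x'} \<subseteq> V" "?f ` {y, x, x'} \<subseteq> V" using E[THEN E_V(1)] E[THEN E_V(2)] by auto
  ultimately have "\<exists>\<phi>. aut \<phi> \<and> (\<forall>v\<in>{y, x, x'}. \<phi> v = ?f v)"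
    using ne xy side by (intro extend[where r = y]) (auto simp: inj_on_def)
  then show ?thesis using xy ne by auto
qed

text \<open>Neighbours of \<open>x\<close> are pairwise non-adjacent, so every permutation of them
  is an isomorphism of the induced star, which is finite by local finiteness.\<close>

lemma extend_star:
  assumes x: "x \<in> V" and \<pi>: "bij_betw \<pi> (N x) (N x)"
  shows "\<exists>\<phi>. aut \<phi> \<and> \<phi> x = x \<and> (\<forall>y\<in>N x. \<phi> y = \<pi> y)"
proof -
  let ?f = "\<lambda>v. if v = x then x else \<pi> v"
  have xN: "x \<notin> N x" using not_E_refl by auto
  have \<pi>N: "E x (\<pi> y)" if "E x y" for y using bij_betwE[OF \<pi>] that by auto
  have nE: "\<not> E y z" if "E x y" "E x z" for y z using that E_X_iff by blast
  have rev: "E y x" "E (\<pi> y) x" if "E x y" for y using that \<pi>N sym by blast+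
  have con: "graph_connected (insert x (N x)) E"
    by (rule graph_connected_star[OF finite_N]) (use sym in auto)
  have inj: "inj_on ?f (insert x (N x))"
    using \<pi> xN \<pi>N by (auto simp: inj_on_def bij_betw_def)
  have iff: "E u v \<longleftrightarrow> E (?f u) (?f v)" if "u \<in> insert x (N x)" "v \<in> insert x (N x)" for u v
  proof (cases "u = x \<or> v = x")
    case True
    then show ?thesis using that not_E_refl \<pi>N[of u] \<pi>N[of v] rev[of u] rev[of v] by auto
  next
    case False
    then show ?thesis using that nE[of u v] nE[OF \<pi>N \<pi>N, of u v] by simp
  qed
  have sub: "insert x (N x) \<subseteq> V" and fsub: "?f ` insert x (N x) \<subseteq> V"
    using x N_subset[of x] \<pi>N by auto
  have "\<exists>\<phi>. aut \<phi> \<and> (\<forall>v\<in>insert x (N x). \<phi> v = ?f v)"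
    by (rule extend[where r = x, OF _ sub con inj fsub iff]) (simp_all add: finite_N)
  then show ?thesis using xN by auto
qed

text \<open>This is how contradictions are produced later: two vertices attached to \<open>S\<close>
  in the same way are indistinguishable over \<open>S\<close>, even if the rest of the graph seems
  to separate them.\<close>

lemma extend_leaf:
  assumes S: "finite S" "S \<subseteq> V" "graph_connected S E" and s: "s \<in> S" "E s w"
    and w: "w \<notin> S" "w' \<notin> S" and E: "\<And>t. t \<in> S \<Longrightarrow> E t w \<longleftrightarrow> E t w'"
  shows "\<exists>\<phi>. aut \<phi> \<and> (\<forall>t\<in>S. \<phi> t = t) \<and> \<phi> w = w'"
proof -
  let ?f = "\<lambda>v. if v = w then w' else v"
  have sw': "E s w'" using E s by blast
  have "graph_connected (insert w S) E" using S(3) s sym by (intro graph_connected_insert) auto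
  moreover have "E u v \<longleftrightarrow> E (?f u) (?f v)" if "u \<in> insert w S" "v \<in> insert w S" for u v
    using that E[of u] E[of v] E_commute[of w] E_commute[of w'] not_E_refl by auto
  moreover have "inj_on ?f (insert w S)" using w by (auto simp: inj_on_def)
  ultimately have "\<exists>\<phi>. aut \<phi> \<and> (\<forall>v\<in>insert w S. \<phi> v = ?f v)"
    by (intro extend[where r = s]) (use S s w E_V(2)[OF s(2)] E_V(2)[OF sw'] in auto)
  then show ?thesis using w by auto
qed

lemma extend_path:
  assumes len: "length ps = length qs" "ps \<noteq> []" and side: "hd ps \<in> X \<longleftrightarrow> hd qs \<in> X"
    and in_V: "set ps \<subseteq> V" "set qs \<subseteq> V"
    and long: "\<And>cs. cycle_list E cs \<Longrightarrow> length cs > length ps"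
    and ps: "distinct ps" "successively E ps" and qs: "distinct qs" "successively E qs"
  shows "\<exists>\<phi>. aut \<phi> \<and> map \<phi> ps = qs"
proof -
  \<comment> \<open>The index is unique for vertices of \<open>ps\<close> because the list is
    distinct; values elsewhere are irrelevant.\<close>
  define f where "f v = qs ! (THE i. i < length ps \<and> ps ! i = v)" for v
  have f: "f (ps ! i) = qs ! i" if "i < length ps" for i
  proof -
    have "(THE k. k < length ps \<and> ps ! k = ps ! i) = i"
      using that ps(1) by (intro the_equality) (auto simp: nth_eq_iff_index_eq)
    then show ?thesis unfolding f_def by simp
  qed
  have Ep: "E (ps ! i) (ps ! j) \<longleftrightarrow> j = i + 1 \<or> i = j + 1" if "i < length ps" "j < length ps" for i j
    by (rule path_induced_of_long_cycles) (use sym not_E_refl long ps that in auto)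
  have Eq: "E (qs ! i) (qs ! j) \<longleftrightarrow> j = i + 1 \<or> i = j + 1" if "i < length ps" "j < length ps" for i j
    by (rule path_induced_of_long_cycles) (use sym not_E_refl long qs that len in auto)
  have "E u v \<longleftrightarrow> E (f u) (f v)" if "u \<in> set ps" "v \<in> set ps" for u v
    using that Ep Eq f by (auto simp: in_set_conv_nth)
  moreover have "inj_on f (set ps)"
    using f qs(1) len by (auto simp: inj_on_def in_set_conv_nth nth_eq_iff_index_eq)
  moreover have "f ` set ps \<subseteq> V"
  proof
    fix v assume "v \<in> f ` set ps"
    then obtain i where "i < length ps" "v = f (ps ! i)" by (auto simp: in_set_conv_nth)
    then show "v \<in> V" using f in_V(2) len nth_mem[of i qs] by auto
  qed
  moreover have "f (hd ps) \<in> X \<longleftrightarrow> hd ps \<in> X"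
  proof -
    have "f (hd ps) = hd qs" using f[of 0] len hd_conv_nth[of ps] hd_conv_nth[of qs] by fastforce
    then show ?thesis using side by simp
  qed
  moreover have "graph_connected (set ps) E"
    using sym len(2) ps(2) by (rule graph_connected_path)
  ultimately have "\<exists>\<phi>. aut \<phi> \<and> (\<forall>v\<in>set ps. \<phi> v = f v)"
    using in_V(1) len(2) by (intro extend[where r = "hd ps"]) auto
  then obtain \<phi> where "aut \<phi>" "\<And>v. v \<in> set ps \<Longrightarrow> \<phi> v = f v" by blast
  then show ?thesis using f len by (intro exI[of _ \<phi>]) (auto intro: nth_equalityI)
qed

end

section \<open>Recognising the graphs in the list\<close>

lemma graph_isomorphicI:
  assumes g: "bij_betw g A V" and E: "\<And>i j. i \<in> A \<Longrightarrow> j \<in> A \<Longrightarrow> E (g i) (g j) \<longleftrightarrow> E' i j"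
  shows "graph_isomorphic V E A E'"
proof -
  have "bij_betw (inv_into A g) V A" using g by (rule bij_betw_inv_into)
  moreover have "E x y \<longleftrightarrow> E' (inv_into A g x) (inv_into A g y)" if "x \<in> V" "y \<in> V" for x y
    using E[of "inv_into A g x" "inv_into A g y"] g that
    by (metis bij_betw_imp_surj_on f_inv_into_f inv_into_into)
  ultimately show ?thesis unfolding graph_isomorphic_def graph_iso_def by blast
qed

context connected_bipartite
begin

lemma complete_isomorphic:
  assumes fin: "finite V" and E: "\<And>x y. x \<in> X \<Longrightarrow> y \<in> Y \<Longrightarrow> E x y"
  shows "\<exists>m n. graph_isomorphic V E {0..<m+n} (Kmn_E m n)"
proof -
  have finXY: "finite X" "finite Y" using fin V_eq by auto
  define m n where "m = card X" and "n = card Y"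
  obtain e where e: "bij_betw e {0..<m} X" using ex_bij_betw_nat_finite[OF finXY(1)] m_def by auto
  obtain e' where e': "bij_betw e' {0..<n} Y" using ex_bij_betw_nat_finite[OF finXY(2)] n_def by auto
  let ?g = "\<lambda>i. if i < m then e i else e' (i - m)"
  have "bij_betw ?g {0..<m} X" using e by (rule bij_betw_cong[THEN iffD1, rotated]) auto
  moreover have "bij_betw ?g {m..<m+n} Y"
  proof -
    have "bij_betw (\<lambda>i. i - m) {m..<m+n} {0..<n}"
      by (rule bij_betw_byWitness[where f' = "\<lambda>i. i + m"]) auto
    from bij_betw_trans[OF this e'] show ?thesis
      by (rule bij_betw_cong[THEN iffD1, rotated]) auto
  qed
  ultimately have "bij_betw ?g ({0..<m} \<union> {m..<m+n}) (X \<union> Y)" using disj by (rule bij_betw_combine)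
  moreover have "{0..<m} \<union> {m..<m+n} = {0..<m+n}" by auto
  ultimately have g: "bij_betw ?g {0..<m+n} V" using V_eq by simp
  have eX: "e i \<in> X" if "i < m" for i using bij_betwE[OF e] that by auto
  have eY: "e' i \<in> Y" if "i < n" for i using bij_betwE[OF e'] that by auto
  have "E (?g i) (?g j) \<longleftrightarrow> Kmn_E m n i j" if "i \<in> {0..<m+n}" "j \<in> {0..<m+n}" for i j
  proof (cases "i < m"; cases "j < m")
    assume "i < m" "j < m"
    then show ?thesis using not_E_XX eX by (simp add: Kmn_E_def)
  next
    assume "i < m" "\<not> j < m"
    then show ?thesis using E eX eY that by (simp add: Kmn_E_def)
  next
    assume "\<not> i < m" "j < m"
    then show ?thesis using E[THEN sym] eX eY that by (simp add: Kmn_E_def)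
  next
    assume "\<not> i < m" "\<not> j < m"
    then show ?thesis using not_E_YY eY that by (simp add: Kmn_E_def)
  qed
  then have "graph_isomorphic V E {0..<m+n} (Kmn_E m n)" by (rule graph_isomorphicI[OF g])
  then show ?thesis by blast
qed

lemma matching_complement_isomorphic:
  assumes fin: "finite V" and \<eta>: "bij_betw \<eta> X Y"
    and E: "\<And>x y. x \<in> X \<Longrightarrow> y \<in> Y \<Longrightarrow> E x y \<longleftrightarrow> y \<noteq> \<eta> x"
  shows "\<exists>n. graph_isomorphic V E {0..<2*n} (cpm_E n)"
proof -
  have finX: "finite X" using fin V_eq by auto
  define n where "n = card X"
  obtain e where e: "bij_betw e {0..<n} X" using ex_bij_betw_nat_finite[OF finX] n_def by auto
  let ?g = "\<lambda>i. if i < n then e i else \<eta> (e (i - n))"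
  have "bij_betw ?g {0..<n} X" using e by (rule bij_betw_cong[THEN iffD1, rotated]) auto
  moreover have "bij_betw ?g {n..<2*n} Y"
  proof -
    have "bij_betw (\<lambda>i. i - n) {n..<2*n} {0..<n}"
      by (rule bij_betw_byWitness[where f' = "\<lambda>i. i + n"]) auto
    from bij_betw_trans[OF bij_betw_trans[OF this e] \<eta>] show ?thesis
      by (rule bij_betw_cong[THEN iffD1, rotated]) auto
  qed
  ultimately have "bij_betw ?g ({0..<n} \<union> {n..<2*n}) (X \<union> Y)" using disj by (rule bij_betw_combine)
  moreover have "{0..<n} \<union> {n..<2*n} = {0..<2*n}" by auto
  ultimately have g: "bij_betw ?g {0..<2*n} V" using V_eq by simp
  have eX: "e i \<in> X" if "i < n" for i using bij_betwE[OF e] that by auto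
  have eY: "\<eta> (e i) \<in> Y" if "i < n" for i using bij_betwE[OF \<eta>] eX that by auto
  have inj: "\<eta> (e i) = \<eta> (e j) \<longleftrightarrow> i = j" if "i < n" "j < n" for i j
  proof -
    have "\<eta> (e i) = \<eta> (e j) \<longleftrightarrow> e i = e j" using \<eta> eX that by (auto simp: bij_betw_def inj_on_def)
    also have "\<dots> \<longleftrightarrow> i = j" using e that by (auto simp: bij_betw_def inj_on_def)
    finally show ?thesis .
  qed
  have main: "E (e i) (\<eta> (e (j - n))) \<longleftrightarrow> j \<noteq> n + i" if "i < n" "n \<le> j" "j < 2 * n" for i j
  proof -
    have "j - n < n" using that by simp
    then have "E (e i) (\<eta> (e (j - n))) \<longleftrightarrow> j - n \<noteq> i" using E[OF eX eY] inj that by simp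
    then show ?thesis using that by auto
  qed
  have "E (?g i) (?g j) \<longleftrightarrow> cpm_E n i j" if "i \<in> {0..<2*n}" "j \<in> {0..<2*n}" for i j
  proof (cases "i < n"; cases "j < n")
    assume "i < n" "j < n"
    then show ?thesis using not_E_XX eX by (simp add: cpm_E_def)
  next
    assume "i < n" "\<not> j < n"
    then show ?thesis using main[of i j] that by (simp add: cpm_E_def)
  next
    assume "\<not> i < n" "j < n"
    then show ?thesis using main[of j i] E_commute that by (simp add: cpm_E_def)
  next
    assume "\<not> i < n" "\<not> j < n"
    moreover from this have "i - n < n" "j - n < n" using that by auto
    ultimately show ?thesis using not_E_YY[OF eY eY] by (simp add: cpm_E_def)
  qed
  then have "graph_isomorphic V E {0..<2*n} (cpm_E n)" by (rule graph_isomorphicI[OF g])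
  then show ?thesis by blast
qed

text \<open>If vertices of \<open>X\<close> have at most one neighbour, the star around
  \<open>y\<close> is closed under neighbours and hence is the whole graph.\<close>

lemma leaf_side_complete:
  assumes fin: "\<And>x. x \<in> X \<Longrightarrow> finite (N x)" and deg: "\<And>x. x \<in> X \<Longrightarrow> card (N x) \<le> 1"
    and xy: "x \<in> X" "y \<in> Y"
  shows "E x y"
proof -
  note y = xy(2)
  have V: "V = insert y (N y)"
  proof (rule closed_eq_V[symmetric])
    show "y \<in> insert y (N y)" by simp
    show "insert y (N y) \<subseteq> V" using y Y_V N_subset by auto
    fix u v assume u: "u \<in> insert y (N y)" and uv: "E u v"
    show "v \<in> insert y (N y)"
    proof (cases "u = y")
      case False
      then have yu: "E y u" using u by simp
      then have "u \<in> X" using y E_YX by blast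
      then have "\<forall>a\<in>N u. \<forall>b\<in>N u. a = b" using card_le_Suc0_iff_eq[OF fin] deg[of u] by simp
      then show ?thesis using uv sym[OF yu] by auto
    qed (use uv in simp)
  qed
  have "x \<in> insert y (N y)" using V X_V xy(1) by auto
  then show ?thesis using xy not_XY sym by auto
qed

lemma path_side:
  assumes "successively E ps" "i < length ps"
  shows "ps ! i \<in> X \<longleftrightarrow> (even i \<longleftrightarrow> hd ps \<in> X)"
  using assms(2)
proof (induction i)
  case 0
  then show ?case by (simp add: hd_conv_nth)
next
  case (Suc i)
  then have "E (ps ! i) (ps ! Suc i)" using assms(1) by (simp add: successively_conv_nth)
  then show ?case using Suc E_X_iff by auto
qed

lemma cycle_list_even:
  assumes "cycle_list E ps" shows "even (length ps)"
proof -
  have ps: "ps \<noteq> []" "length ps \<ge> 3" "successively E ps" "E (last ps) (hd ps)"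
    using assms unfolding cycle_list_def by auto
  have "last ps = ps ! (length ps - 1)" using ps by (simp add: last_conv_nth)
  then have "last ps \<in> X \<longleftrightarrow> (even (length ps - 1) \<longleftrightarrow> hd ps \<in> X)"
    using path_side[OF ps(3), of "length ps - 1"] ps(2) by simp
  then show ?thesis using E_X_iff[OF ps(4)] ps(2) by auto
qed

lemma cycle_list_nth:
  assumes "cycle_list E ps" "i < length ps"
  shows "E (ps ! i) (ps ! (if i + 1 = length ps then 0 else i + 1))"
proof -
  have ps: "ps \<noteq> []" "successively E ps" "E (last ps) (hd ps)"
    using assms(1) unfolding cycle_list_def by auto
  show ?thesis
  proof (cases "i + 1 = length ps")
    case True
    then have "length ps - 1 = i" by simp
    then show ?thesis using ps(1,3) True by (simp add: last_conv_nth hd_conv_nth)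
  next
    case False
    then show ?thesis using ps(2) assms(2) by (simp add: successively_conv_nth)
  qed
qed

lemma cycle_list_V:
  assumes "cycle_list E ps" shows "set ps \<subseteq> V"
  using cycle_list_nth[OF assms] E_V(1) by (fastforce simp: in_set_conv_nth)

lemma graph_acyclic_iff: "graph_acyclic V E \<longleftrightarrow> (\<forall>ps. \<not> cycle_list E ps)"
proof -
  have "cycle_list E ps \<longleftrightarrow> length ps \<ge> 3 \<and> distinct ps \<and> set ps \<subseteq> V \<and>
      (\<forall>i. i + 1 < length ps \<longrightarrow> E (ps ! i) (ps ! (i + 1))) \<and> E (last ps) (hd ps)" for ps
    using cycle_list_V[of ps] unfolding cycle_list_def by (auto simp: successively_conv_nth)
  then show ?thesis unfolding graph_acyclic_def by blast
qed

text \<open>The first vertex of a longest path has all its neighbours on the path, and a neighbour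
  beyond the second vertex would close a cycle.\<close>

lemma finite_acyclic_leaf:
  assumes fin: "finite V" and ac: "graph_acyclic V E"
  shows "\<exists>v\<in>V. card (N v) \<le> 1"
proof -
  define P where "P ps \<longleftrightarrow> ps \<noteq> [] \<and> distinct ps \<and> set ps \<subseteq> V \<and> successively E ps" for ps
  obtain r where r: "r \<in> V" using conn unfolding graph_connected_def by blast
  have "P [r]" unfolding P_def using r by simp
  moreover have "length ps \<le> card V" if "P ps" for ps
    using that fin unfolding P_def by (metis card_mono distinct_card)
  ultimately obtain ps where ps: "P ps" and max: "\<And>qs. P qs \<Longrightarrow> length qs \<le> length ps"
    using ex_has_greatest_nat[of P "[r]" length "Suc (card V)"] by (auto simp: less_Suc_eq_le)
  define v where "v = hd ps"
  have vV: "v \<in> V" and v0: "v = ps ! 0"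
    using ps unfolding P_def v_def by (auto simp: hd_conv_nth)
  have in_ps: "u \<in> set ps" if "E v u" for u
  proof (rule ccontr)
    assume "u \<notin> set ps"
    then have "P (u # ps)" using ps that sym E_V unfolding P_def v_def
      by (auto simp: successively_Cons)
    from max[OF this] show False by simp
  qed
  have "u = ps ! 1" if "E v u" for u
  proof (rule ccontr)
    assume ne: "u \<noteq> ps ! 1"
    obtain k where k: "k < length ps" "u = ps ! k" using in_ps[OF \<open>E v u\<close>] by (auto simp: in_set_conv_nth)
    have "k \<noteq> 0" using k v0 \<open>E v u\<close> not_E_refl by metis
    moreover have "k \<noteq> 1" using k ne by metis
    ultimately have "k \<ge> 2" by simp
    have "cycle_list E (take (k + 1) ps)"
      unfolding cycle_list_def
    proof (intro conjI)
      show "3 \<le> length (take (k + 1) ps)" using k \<open>k \<ge> 2\<close> by simp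
      show "distinct (take (k + 1) ps)" using ps unfolding P_def by simp
      show "successively E (take (k + 1) ps)" using ps k unfolding P_def by (auto simp: successively_conv_nth)
      have "last (take (k + 1) ps) = u" using k by (simp add: take_Suc_conv_app_nth)
      moreover have "hd (take (k + 1) ps) = v" using v_def by simp
      ultimately show "E (last (take (k + 1) ps)) (hd (take (k + 1) ps))" using \<open>E v u\<close> sym by simp
    qed
    then show False using ac graph_acyclic_iff by blast
  qed
  \<comment> \<open>For a path with one vertex, \<open>ps ! 1\<close> is an unspecified value, but
    then \<open>v\<close> has no neighbours and the inclusion still holds.\<close>
  then have "N v \<subseteq> {ps ! 1}" by auto
  then have "card (N v) \<le> 1" using card_mono[of "{ps ! 1}" "N v"] by simp
  then show ?thesis using vV by blast
qed

text \<open>The two neighbours of a vertex on the cycle are already its predecessor and successor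
  there, so the cycle is closed under neighbours and has no chords.\<close>

lemma two_regular_cycle:
  assumes cyc: "cycle_list E ps" and fin: "\<And>v. finite (N v)" and deg: "\<And>v. v \<in> V \<Longrightarrow> card (N v) \<le> 2"
  shows "graph_isomorphic V E {0..<length ps} (cycle_E (length ps))"
proof -
  define n where "n = length ps"
  have n: "n \<ge> 3" and dist: "distinct ps" using cyc unfolding cycle_list_def n_def by auto
  define s where "s i = (if i + 1 = n then 0 else i + 1)" for i
  define p where "p i = (if i = 0 then n - 1 else i - 1)" for i
  have sp: "s i < n" "p i < n" "s i \<noteq> p i" "s (p i) = i" "p (s i) = i" if "i < n" for i
    using that n unfolding s_def p_def by auto
  have Es: "E (ps ! i) (ps ! s i)" if "i < n" for i
    using cycle_list_nth[OF cyc] that unfolding s_def n_def by simp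
  have Np: "N (ps ! i) = {ps ! s i, ps ! p i}" if "i < n" for i
  proof (rule card_seteq[symmetric])
    have "E (ps ! p i) (ps ! i)" using Es[of "p i"] sp[OF that] by simp
    then show "{ps ! s i, ps ! p i} \<subseteq> N (ps ! i)" using Es[OF that] sym by auto
    have "ps ! s i \<noteq> ps ! p i" using sp[OF that] dist unfolding n_def by (simp add: nth_eq_iff_index_eq)
    moreover have "ps ! i \<in> V" using cycle_list_V[OF cyc] that unfolding n_def by auto
    ultimately show "card (N (ps ! i)) \<le> card {ps ! s i, ps ! p i}" using deg[of "ps ! i"] by simp
  qed (rule fin)
  have "set ps = V"
  proof (rule closed_eq_V)
    show "ps ! 0 \<in> set ps" using n unfolding n_def by (intro nth_mem) linarith
    show "set ps \<subseteq> V" using cyc by (rule cycle_list_V)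
    fix u v assume "u \<in> set ps" "E u v"
    then obtain i where "i < n" "u = ps ! i" unfolding n_def by (auto simp: in_set_conv_nth)
    then have "v = ps ! s i \<or> v = ps ! p i" using Np[of i] \<open>E u v\<close> by auto
    then show "v \<in> set ps" using sp[OF \<open>i < n\<close>] unfolding n_def by auto
  qed
  then have "bij_betw (\<lambda>i. ps ! i) {0..<n} V"
    using dist unfolding n_def by (auto simp: bij_betw_def inj_on_def nth_eq_iff_index_eq set_conv_nth)
  moreover have "E (ps ! i) (ps ! j) \<longleftrightarrow> cycle_E n i j" if "i \<in> {0..<n}" "j \<in> {0..<n}" for i j
  proof -
    have ij: "i < n" "j < n" using that by auto
    have md: "(k + 1) mod n = s k" if "k < n" for k using that unfolding s_def by auto
    have "E (ps ! i) (ps ! j) \<longleftrightarrow> ps ! j = ps ! s i \<or> ps ! j = ps ! p i" using Np[OF ij(1)] by auto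
    also have "\<dots> \<longleftrightarrow> j = s i \<or> j = p i"
      using ij sp[OF ij(1)] dist unfolding n_def by (simp add: nth_eq_iff_index_eq)
    also have "\<dots> \<longleftrightarrow> j = s i \<or> i = s j" using sp ij by metis
    finally show ?thesis unfolding cycle_E_def using ij md by simp
  qed
  ultimately show ?thesis unfolding n_def[symmetric] by (rule graph_isomorphicI)
qed

end

section \<open>Cycles without squares force degree two\<close>

lemma ex_notin_if_card_less:
  assumes "card B < card A" "finite B" shows "\<exists>x\<in>A. x \<notin> B"
  using assms by (meson card_mono linorder_not_le subsetI)

lemma ex_notin2:
  assumes "card A \<ge> 3" shows "\<exists>x\<in>A. x \<noteq> a \<and> x \<noteq> b"
proof -
  have "card {a, b} \<le> 2" by (simp add: card_insert_if)
  then show ?thesis using ex_notin_if_card_less[of "{a, b}" A] assms by auto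
qed

lemma ex_notin1:
  assumes "card A \<ge> 2" shows "\<exists>x\<in>A. x \<noteq> a"
  using ex_notin_if_card_less[of "{a}" A] assms by auto

context connected_bipartite
begin

text \<open>Bipartite graphs have only even cycles, and a cycle of length four would be a
  square.\<close>

lemma square_free_cycle_length:
  assumes sqf: "\<And>x x' y y'. E x y \<Longrightarrow> E x y' \<Longrightarrow> E x' y \<Longrightarrow> E x' y' \<Longrightarrow> x = x' \<or> y = y'"
    and cyc: "cycle_list E ps"
  shows "length ps \<ge> 6"
proof (rule ccontr)
  assume "\<not> length ps \<ge> 6"
  moreover have "length ps \<ge> 3" "even (length ps)"
    using cyc cycle_list_even unfolding cycle_list_def by auto
  ultimately have "length ps = 4" by presburger
  then obtain a b c d where ps: "ps = [a, b, c, d]" by (auto simp: length_Suc_conv eval_nat_numeral)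
  then have "E a b" "E b c" "E c d" "E d a" "a \<noteq> c" "b \<noteq> d" using cyc unfolding cycle_list_def by auto
  then show False using sqf[of a b d c] sym by blast
qed

end

context homogeneous_bipartite
begin

text \<open>Replacing the last vertex of the path formed by all but one vertex of a shortest cycle
  produces a hexagon.\<close>

lemma hexagon_of_cycle:
  assumes sqf: "\<And>x x' y y'. E x y \<Longrightarrow> E x y' \<Longrightarrow> E x' y \<Longrightarrow> E x' y' \<Longrightarrow> x = x' \<or> y = y'"
    and cyc: "cycle_list E cs" and deg: "\<And>y. y \<in> Y \<Longrightarrow> card (N y) \<ge> 3"
  shows "\<exists>ps. cycle_list E ps \<and> length ps = 6 \<and> hd ps \<in> X"
proof -
  obtain ps0 where ps0: "cycle_list E ps0" and min0: "\<And>qs. cycle_list E qs \<Longrightarrow> length ps0 \<le> length qs"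
    using ex_has_least_nat[of "cycle_list E" cs length] cyc by auto
  \<comment> \<open>Starting in \<open>X\<close> puts the third vertex from the end into
    \<open>Y\<close>, where degree at least three is available for branching off.\<close>
  have "\<exists>ps. cycle_list E ps \<and> length ps = length ps0 \<and> hd ps \<in> X"
  proof (cases "hd ps0 \<in> X")
    case True
    then show ?thesis using ps0 by blast
  next
    case False
    obtain x y zs where eq: "ps0 = x # y # zs"
      using ps0 unfolding cycle_list_def by (cases ps0; cases "tl ps0") auto
    then have "E x y" using ps0 unfolding cycle_list_def by (simp add: successively_Cons)
    then have "hd (rotate1 ps0) \<in> X" using eq False E_X_iff by auto
    then show ?thesis using cycle_list_rotate1[OF ps0] by (intro exI[of _ "rotate1 ps0"]) simp
  qed
  then obtain ps where ps: "cycle_list E ps" "hd ps \<in> X"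
    and min: "\<And>qs. cycle_list E qs \<Longrightarrow> length ps \<le> length qs" using min0 by metis
  define n where "n = length ps"
  have n6: "n \<ge> 6" unfolding n_def using square_free_cycle_length[OF sqf ps(1)] .
  have "n = 6"
  proof (rule ccontr)
    assume "n \<noteq> 6"
    then have n7: "n \<ge> 7" using n6 by simp
    have dist: "distinct ps" and suc: "successively E ps" and setV: "set ps \<subseteq> V"
      using ps(1) cycle_list_V unfolding cycle_list_def by auto
    have step: "E (ps ! i) (ps ! (i + 1))" if "i + 1 < n" for i
      using suc that unfolding n_def by (simp add: successively_conv_nth)
    have neq: "ps ! i \<noteq> ps ! j" if "i < n" "j < n" "i \<noteq> j" for i j
      using dist that unfolding n_def by (simp add: nth_eq_iff_index_eq)
    define a b c e where "a = ps ! 0" and "b = ps ! (n - 1)" and "c = ps ! (n - 2)" and "e = ps ! (n - 3)"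
    have "ps \<noteq> []" using n6 unfolding n_def by auto
    then have ba: "E b a" unfolding a_def b_def n_def
      using ps(1) unfolding cycle_list_def by (simp add: last_conv_nth hd_conv_nth)
    have cb: "E c b" and ec: "E e c"
      unfolding b_def c_def e_def using step[of "n - 2"] step[of "n - 3"] n7 by (simp_all add: Suc_diff_Suc numeral_eq_Suc)
    have aX: "a \<in> X" unfolding a_def using ps(2) n6 hd_conv_nth[of ps] unfolding n_def by fastforce
    have sides: "b \<notin> X" "c \<in> X" "e \<notin> X" using aX E_X_iff[OF ba] E_X_iff[OF cb] E_X_iff[OF ec] by auto
    have "e \<in> Y" using sides E_V[OF ec] in_Y_iff by blast
    \<comment> \<open>\<open>e\<close> has the two cycle neighbours \<open>c\<close> and
      \<open>ps ! (n - 4)\<close>; \<open>d\<close> is a third neighbour, an alternative end for the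
      path.\<close>
    from ex_notin2[OF deg[OF this], of c "ps ! (n - 4)"]
    obtain d where d: "E e d" "d \<noteq> c" "d \<noteq> ps ! (n - 4)" by auto
    define qs where "qs = take (n - 2) ps"
    have len_q: "length qs = n - 2" unfolding qs_def n_def by simp
    have nth_q: "qs ! i = ps ! i" if "i < n - 2" for i using that unfolding qs_def by simp
    have dist_q: "distinct qs" unfolding qs_def using dist by simp
    have suc_q: "successively E qs"
      using suc len_q nth_q unfolding n_def by (auto simp: successively_conv_nth)
    have ind: "E (qs ! i) (qs ! j) \<longleftrightarrow> j = i + 1 \<or> i = j + 1" if "i < n - 2" "j < n - 2" for i j
    proof (rule path_induced_of_long_cycles)
      show "length qs < length cs" if "cycle_list E cs" for cs
        using min[OF that] len_q n6 unfolding n_def[symmetric] by simp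
    qed (use sym not_E_refl dist_q suc_q that len_q in auto)
    have qne: "qs \<noteq> []" using len_q n7 by auto
    have last_q: "last qs = e" unfolding e_def using qne len_q nth_q[of "n - 3"] n7
      by (simp add: last_conv_nth numeral_eq_Suc)
    have hd_q: "hd qs = a" unfolding a_def using qne len_q nth_q[of 0] n7 by (simp add: hd_conv_nth)
    have d_new: "d \<notin> set qs"
    proof
      assume "d \<in> set qs"
      then obtain k where k: "k < n - 2" "d = qs ! k" using len_q by (auto simp: in_set_conv_nth)
      have "e = qs ! (n - 3)" unfolding e_def using nth_q[of "n - 3"] n7 by simp
      then have "k = n - 3 + 1 \<or> n - 3 = k + 1" using d(1) ind[of "n - 3" k] k n7 by simp
      then have "k = n - 4" using k n7 by auto
      then show False using d(3) k nth_q[of k] by simp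
    qed
    have c_new: "c \<notin> set qs"
    proof
      assume "c \<in> set qs"
      then obtain k where "k < n - 2" "c = ps ! k" using len_q nth_q by (auto simp: in_set_conv_nth)
      then show False unfolding c_def using neq[of k "n - 2"] n7 by auto
    qed
    \<comment> \<open>Both paths have \<open>n - 1\<close> vertices, fewer than the girth, and so
      are induced. As \<open>b\<close> joins \<open>c\<close> to \<open>a\<close>, its image joins
      \<open>d\<close> to \<open>a\<close>, which closes the hexagon
      \<open>a, b, c, e, d, \<phi> b\<close>.\<close>
    have "\<exists>\<phi>. aut \<phi> \<and> map \<phi> (qs @ [c]) = qs @ [d]"
    proof (rule extend_path)
      show "length cs > length (qs @ [c])" if "cycle_list E cs" for cs
        using min[OF that] len_q n7 unfolding n_def[symmetric] by simp
      show "set (qs @ [c]) \<subseteq> V" "set (qs @ [d]) \<subseteq> V"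
        using setV E_V[OF ec] E_V[OF d(1)] set_take_subset[of "n - 2" ps] unfolding qs_def by auto
    qed (use qne dist_q suc_q c_new d_new last_q ec d(1) in \<open>auto simp: successively_append_iff\<close>)
    then obtain \<phi> where \<phi>: "aut \<phi>" "map \<phi> qs = qs" "\<phi> c = d" by auto
    have "\<phi> a = a" using \<phi>(2) qne hd_q by (metis hd_map)
    then have ga: "E (\<phi> b) a" and gd: "E d (\<phi> b)" using aut_E[OF \<phi>(1) ba] aut_E[OF \<phi>(1) cb] \<phi>(3) by auto
    have "b \<noteq> e" unfolding b_def e_def using neq n7 by simp
    have "\<phi> b \<noteq> b"
    proof
      assume "\<phi> b = b"
      then show False using sqf[of b c d e] cb gd ec d(1,2) sym \<open>b \<noteq> e\<close> by metis
    qed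
    have "\<phi> b \<noteq> e"
    proof
      assume "\<phi> b = e"
      moreover have "e = qs ! (n - 3)" "a = qs ! 0" unfolding e_def a_def using nth_q n7 by auto
      ultimately have "E (qs ! (n - 3)) (qs ! 0)" using ga by simp
      then show False using ind[of "n - 3" 0] n7 by simp
    qed
    have "a \<noteq> c" unfolding a_def c_def using neq n7 by simp
    have "d \<noteq> a" using d_new hd_q qne by auto
    have "d \<in> X" "\<phi> b \<notin> X" using sides E_X_iff[OF d(1)] E_X_iff[OF ga] aX by auto
    then have "cycle_list E [a, b, c, e, d, \<phi> b]"
      using aX sides \<open>\<phi> b \<noteq> b\<close> \<open>\<phi> b \<noteq> e\<close> \<open>a \<noteq> c\<close> \<open>d \<noteq> a\<close> \<open>b \<noteq> e\<close> d ba[THEN sym] cb[THEN sym] ec[THEN sym] ga gd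
      unfolding cycle_list_def by auto
    from min[OF this] show False using n7 unfolding n_def by simp
  qed
  then show ?thesis using ps unfolding n_def by blast
qed

text \<open>All paths with five vertices starting in \<open>X\<close> are induced and equivalent. In
  the hexagon the ends \<open>c0\<close>, \<open>c4\<close> of such a path share the neighbour
  \<open>c5\<close>. Hence sharing a neighbour is transitive on \<open>X\<close>, and connectivity
  spreads it to all pairs.\<close>

lemma hexagon_common_neighbour:
  assumes sqf: "\<And>x x' y y'. E x y \<Longrightarrow> E x y' \<Longrightarrow> E x' y \<Longrightarrow> E x' y' \<Longrightarrow> x = x' \<or> y = y'"
    and hex: "cycle_list E [c0, c1, c2, c3, c4, c5]" "c0 \<in> X" and xz: "x \<in> X" "z \<in> X"
  shows "\<exists>w. E x w \<and> E z w"
proof -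
  have long: "length cs \<ge> 6" if "cycle_list E cs" for cs
    using square_free_cycle_length[OF sqf that] .
  have c: "E c0 c1" "E c1 c2" "E c2 c3" "E c3 c4" "E c4 c5" "E c5 c0" "distinct [c0, c1, c2, c3, c4, c5]"
    using hex(1) unfolding cycle_list_def by auto
  have trans: "\<exists>w. E p w \<and> E r w" if pX: "p \<in> X" and E: "E p m" "E q m" "E q m'" "E r m'" for p q r m m'
  proof (cases "p = q \<or> q = r \<or> p = r \<or> m = m'")
    case True
    then show ?thesis using E by auto
  next
    case False
    have sd: "m \<notin> X" "q \<in> X" "m' \<notin> X" "r \<in> X" using pX E[THEN E_X_iff] by auto
    have "\<exists>\<phi>. aut \<phi> \<and> map \<phi> [c0, c1, c2, c3, c4] = [p, m, q, m', r]"
    proof (rule extend_path)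
      show "length cs > length [c0, c1, c2, c3, c4]" if "cycle_list E cs" for cs
        using long[OF that] by simp
      show "set [c0, c1, c2, c3, c4] \<subseteq> V" using c(1-5)[THEN E_V(1)] by simp
      show "set [p, m, q, m', r] \<subseteq> V" using E[THEN E_V(1)] E[THEN E_V(2)] by simp
      show "successively E [p, m, q, m', r]" using E E[THEN sym] by simp
      show "distinct [p, m, q, m', r]" using False sd pX by auto
    qed (use c pX hex(2) in auto)
    then obtain \<phi> where \<phi>: "aut \<phi>" "\<phi> c0 = p" "\<phi> c4 = r" by auto
    then show ?thesis using aut_E[OF \<phi>(1) c(5)] aut_E[OF \<phi>(1) c(6)[THEN sym]] by auto
  qed
  define C where "C = {z. \<exists>w. E x w \<and> E z w}"
  have "V \<noteq> {x}" using c(1)[THEN E_V(1)] c(1)[THEN E_V(2)] not_E_refl c(1) by auto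
  then have "x \<in> C" unfolding C_def using graph_connected_ex_neighbour[OF conn] xz X_V by blast
  have CX: "u \<in> X" if "u \<in> C" for u using that xz E_X_iff unfolding C_def by blast
  have "C \<union> {m. \<exists>u\<in>C. E u m} = V"
  proof (rule closed_eq_V[of x])
    show "x \<in> C \<union> {m. \<exists>u\<in>C. E u m}" using \<open>x \<in> C\<close> by blast
    show "C \<union> {m. \<exists>u\<in>C. E u m} \<subseteq> V" using CX X_V E_V by blast
    fix u v assume u: "u \<in> C \<union> {m. \<exists>u\<in>C. E u m}" and uv: "E u v"
    show "v \<in> C \<union> {m. \<exists>u\<in>C. E u m}"
    proof (cases "u \<in> C")
      case False
      then obtain q w where "E x w" "E q w" "E q u" using u unfolding C_def by auto
      then have "v \<in> C" unfolding C_def using trans[OF xz(1), of w q u v] sym[OF uv] by simp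
      then show ?thesis ..
    qed (use uv in auto)
  qed
  moreover have "z \<notin> {m. \<exists>u\<in>C. E u m}" using xz CX E_X_iff by blast
  ultimately have "z \<in> C" using xz X_V by blast
  then show ?thesis unfolding C_def by auto
qed

text \<open>With every two vertices of either part having exactly one common neighbour, the graph is the
  incidence graph of a possibly degenerate projective plane. On three lines \<open>l1, l2, l3\<close> through
  a point \<open>p\<close>, a transversal \<open>m\<close> distinguishes its point on \<open>l3\<close> from another point of \<open>l3\<close>,
  although both give the same induced tree.\<close>

lemma no_hexagon:
  assumes sqf: "\<And>x x' y y'. E x y \<Longrightarrow> E x y' \<Longrightarrow> E x' y \<Longrightarrow> E x' y' \<Longrightarrow> x = x' \<or> y = y'"
    and hex: "cycle_list E [c0, c1, c2, c3, c4, c5]" "c0 \<in> X"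
    and degX: "\<And>x. x \<in> X \<Longrightarrow> card (N x) \<ge> 2" and degY: "\<And>y. y \<in> Y \<Longrightarrow> card (N y) \<ge> 3"
  shows False
proof -
  interpret swapped: homogeneous_bipartite V E Y X by (rule homogeneous_swap)
  have comX: "\<exists>w. E x w \<and> E z w" if "x \<in> X" "z \<in> X" for x z
    using hexagon_common_neighbour[OF sqf hex that] .
  have hex': "cycle_list E [c1, c2, c3, c4, c5, c0]" using cycle_list_rotate1[OF hex(1)] by simp
  have "E c0 c1" using hex(1) unfolding cycle_list_def by simp
  then have "c1 \<in> Y" using hex(2) E_XY by blast
  have comY: "\<exists>w. E x w \<and> E z w" if "x \<in> Y" "z \<in> Y" for x z
    using swapped.hexagon_common_neighbour[OF sqf hex' \<open>c1 \<in> Y\<close> that] .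
  define p where "p = c0"
  have pX: "p \<in> X" unfolding p_def by (fact hex(2))
  show False
  proof (cases "card (N p) \<ge> 3")
    case True
    obtain l1 where l1: "E p l1" using \<open>E c0 c1\<close> unfolding p_def by blast
    obtain l2 where l2: "E p l2" "l2 \<noteq> l1" using ex_notin2[OF True, of l1 l1] by auto
    obtain l3 where l3: "E p l3" "l3 \<noteq> l1" "l3 \<noteq> l2" using ex_notin2[OF True, of l1 l2] by auto
    have lY: "l1 \<in> Y" "l2 \<in> Y" "l3 \<in> Y" using pX E_XY l1 l2 l3 by blast+
    obtain p1 where p1: "E l1 p1" "p1 \<noteq> p" using ex_notin2[OF degY[OF lY(1)], of p p] by auto
    obtain p2 where p2: "E l2 p2" "p2 \<noteq> p" using ex_notin2[OF degY[OF lY(2)], of p p] by auto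
    have pX': "p1 \<in> X" "p2 \<in> X" using lY p1 p2 E_YX by blast+
    obtain m where m: "E p1 m" "E p2 m" using comX[OF pX'] by blast
    have mY: "m \<in> Y" using E_XY[OF m(1) pX'(1)] .
    have off: "\<not> E l q" if "E l' q" "q \<noteq> p" "E p l" "E p l'" "l \<noteq> l'" for l l' q
      using sqf[of p l l' q] that sym by blast
    have ml: "m \<noteq> l1" "m \<noteq> l3"
      using off[OF p2 l1 l2(1)] off[OF p1 l3(1) l1] l2 l3 m sym by blast+
    obtain p3 where p3: "E m p3" "E l3 p3" using comY[OF mY lY(3)] by blast
    have "p3 \<noteq> p" using sqf[of p l1 m p1] p3 l1 p1 m ml sym by blast
    obtain q where q: "E l3 q" "q \<noteq> p" "q \<noteq> p3" using ex_notin2[OF degY[OF lY(3)], of p p3] by auto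
    have "\<not> E m q" using sqf[of m p3 q l3] p3 q ml sym by blast
    have p3X: "p3 \<in> X" "q \<in> X" using E_YX lY p3 q by blast+
    \<comment> \<open>Within this tree both \<open>p3\<close> and \<open>q\<close> are adjacent only
      to \<open>l3\<close>, although only \<open>p3\<close> lies on the transversal \<open>m\<close>
      through \<open>p1\<close> and \<open>p2\<close>.\<close>
    let ?S = "insert p2 (insert p1 (insert p {l1, l2, l3}))"
    have con: "graph_connected ?S E"
    proof (intro graph_connected_insert[of _ _ l2 p2] graph_connected_insert[of _ _ l1 p1] graph_connected_star)
    qed (use p1 p2 p1(1)[THEN sym] p2(1)[THEN sym] l1 l2 l3 l1[THEN sym] l2(1)[THEN sym] l3(1)[THEN sym] in auto)
    have "p3 \<noteq> p1" "p3 \<noteq> p2" "q \<noteq> p1" "q \<noteq> p2"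
      using off[OF p1 l3(1) l1] off[OF p2 l3(1) l2(1)] l3 p3 q by auto
    then have "\<exists>\<phi>. aut \<phi> \<and> (\<forall>t\<in>?S. \<phi> t = t) \<and> \<phi> p3 = q"
    proof (intro extend_leaf[where s = l3])
      show "?S \<subseteq> V" using pX pX' lY X_V Y_V by auto
      show "p3 \<notin> ?S" "q \<notin> ?S"
        using \<open>p3 \<noteq> p1\<close> \<open>p3 \<noteq> p2\<close> \<open>q \<noteq> p1\<close> \<open>q \<noteq> p2\<close> \<open>p3 \<noteq> p\<close> q lY p3X not_XY by auto
      have "\<not> E l1 p3" "\<not> E l2 p3" "\<not> E l1 q" "\<not> E l2 q"
        using off[OF p3(2) \<open>p3 \<noteq> p\<close> _ l3(1)] off[OF q(1,2) _ l3(1)] l1 l2 l3 by auto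
      then show "E t p3 \<longleftrightarrow> E t q" if "t \<in> ?S" for t
        using that not_E_XX[OF _ p3X(1)] not_E_XX[OF _ p3X(2)] pX pX' p3 q by auto
    qed (use con p3 in auto)
    then obtain \<phi> where \<phi>: "aut \<phi>" "\<phi> p1 = p1" "\<phi> p2 = p2" "\<phi> p3 = q" by auto
    \<comment> \<open>\<open>\<phi> m\<close> still joins \<open>p1\<close> and \<open>p2\<close>,
      so the absence of squares forces it to be \<open>m\<close>; but it passes through
      \<open>q\<close>, which is not on \<open>m\<close>.\<close>
    have "E p1 (\<phi> m)" "E p2 (\<phi> m)" "E (\<phi> m) q"
      using aut_E[OF \<phi>(1) m(1)] aut_E[OF \<phi>(1) m(2)] aut_E[OF \<phi>(1) p3(1)] \<phi> by auto
    moreover have "p1 \<noteq> p2" using off[OF p2 l1 l2(1)] l2 p1 by auto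
    ultimately show False using sqf[of p1 m "\<phi> m" p2] m \<open>\<not> E m q\<close> by metis
  next
    case False
    \<comment> \<open>The degenerate case with at most two lines through a point. On
      \<open>l1\<close> lie \<open>p\<close>, \<open>q\<close>, \<open>q'\<close>, with second lines
      \<open>l2\<close>, \<open>m\<close>, \<open>m'\<close>. The point \<open>r'\<close> where
      \<open>l2\<close> and \<open>m'\<close> meet has no further line, so it cannot be joined to
      \<open>q\<close>.\<close>
    have deg2: "card (N x) \<le> 2" if "x \<in> X" for x
      using card_N_eq[of x p] that False pX X_V by simp
    have two: "l = l' \<or> l = l'' \<or> l' = l''" if "x \<in> X" "E x l" "E x l'" "E x l''" for x l l' l''
    proof (rule ccontr)
      assume "\<not> ?thesis"
      then have "card {l, l', l''} = 3" by auto
      moreover have "{l, l', l''} \<subseteq> N x" using that by auto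
      ultimately show False using card_mono[OF finite_N, of "{l, l', l''}" x] deg2[OF that(1)] by simp
    qed
    obtain l1 where l1: "E p l1" using \<open>E c0 c1\<close> unfolding p_def by blast
    have l1Y: "l1 \<in> Y" using E_XY[OF l1 pX] .
    obtain q where q: "E l1 q" "q \<noteq> p" using ex_notin2[OF degY[OF l1Y], of p p] by auto
    obtain q' where q': "E l1 q'" "q' \<noteq> p" "q' \<noteq> q" using ex_notin2[OF degY[OF l1Y], of p q] by auto
    have qX: "q \<in> X" "q' \<in> X" using E_YX l1Y q q' by blast+
    obtain l2 where l2: "E p l2" "l2 \<noteq> l1" using ex_notin1[OF degX[OF pX], of l1] by auto
    obtain m where m: "E q m" "m \<noteq> l1" using ex_notin1[OF degX[OF qX(1)], of l1] by auto
    obtain m' where m': "E q' m'" "m' \<noteq> l1" using ex_notin1[OF degX[OF qX(2)], of l1] by auto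
    have Y: "l2 \<in> Y" "m \<in> Y" "m' \<in> Y" using E_XY pX qX l2 m m' by blast+
    have "m \<noteq> m'" using sqf[of q l1 m q'] q q' m m' sym by blast
    have "m \<noteq> l2" using sqf[of p l1 m q] q m l1 l2 sym by blast
    have "m' \<noteq> l2" using sqf[of p l1 m' q'] q' m' l1 l2 sym by blast
    obtain r' where r': "E m' r'" "E l2 r'" using comY[OF Y(3,1)] by blast
    have rX: "r' \<in> X" using E_YX r' Y by blast
    obtain w where w: "E q w" "E r' w" using comX[OF qX(1) rX] by blast
    have "w = l1 \<or> w = m" using two[OF qX(1), of w l1 m] w q m sym by blast
    moreover have "w = l2 \<or> w = m'" using two[OF rX, of w l2 m'] w r' sym \<open>m' \<noteq> l2\<close> by blast
    ultimately show False using \<open>m \<noteq> m'\<close> \<open>m \<noteq> l2\<close> l2 m' by blast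
  qed
qed

lemma cycle_has_square:
  assumes cyc: "cycle_list E cs"
    and degX: "\<And>x. x \<in> X \<Longrightarrow> card (N x) \<ge> 2" and degY: "\<And>y. y \<in> Y \<Longrightarrow> card (N y) \<ge> 3"
  shows "\<exists>x x' y y'. x \<noteq> x' \<and> y \<noteq> y' \<and> E x y \<and> E x y' \<and> E x' y \<and> E x' y'"
proof (rule ccontr)
  assume "\<not> ?thesis"
  then have sqf: "\<And>x x' y y'. E x y \<Longrightarrow> E x y' \<Longrightarrow> E x' y \<Longrightarrow> E x' y' \<Longrightarrow> x = x' \<or> y = y'" by blast
  obtain ps where ps: "cycle_list E ps" "length ps = 6" "hd ps \<in> X"
    using hexagon_of_cycle[OF sqf cyc degY] by blast
  then obtain c0 c1 c2 c3 c4 c5 where "ps = [c0, c1, c2, c3, c4, c5]"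
    by (auto simp: length_Suc_conv eval_nat_numeral)
  with ps no_hexagon[OF sqf _ _ degX degY] show False by auto
qed

end

section \<open>Graphs with a square\<close>

context homogeneous_bipartite
begin

text \<open>Paths with three vertices and middle in the same part are equivalent, so the number
  \<open>k\<close> of common neighbours depends only on the part.\<close>

lemma card_common_eq:
  assumes "E y x" "E y x'" "x \<noteq> x'" "E w z" "E w z'" "z \<noteq> z'" "y \<in> X \<longleftrightarrow> w \<in> X"
  shows "card (N x \<inter> N x') = card (N z \<inter> N z')"
proof -
  obtain \<phi> where "aut \<phi>" "\<phi> x = z" "\<phi> x' = z'" using extend_cherry[of y x x' w z z'] assms by blast
  then show ?thesis using aut_card_Int[of \<phi> x x'] E_V assms by metis
qed

text \<open>A bijection from the common neighbours onto \<open>A\<close> extends to a permutation of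
  \<open>N x\<close>, then to an automorphism fixing \<open>x\<close>; the witness is the image of
  \<open>x'\<close>.\<close>

lemma realise_common_neighbours:
  assumes x: "x \<in> V" "x' \<in> V" and A: "A \<subseteq> N x" "card A = card (N x \<inter> N x')"
  shows "\<exists>u. N x \<inter> N u = A"
proof -
  let ?K = "N x \<inter> N x'"
  have "finite A" using A(1) finite_N finite_subset by blast
  then obtain f where f: "bij_betw f ?K A" using finite_same_card_bij[of ?K A] finite_N A(2) by auto
  then obtain \<pi> where \<pi>: "bij_betw \<pi> (N x) (N x)" "\<forall>y\<in>?K. \<pi> y = f y"
    using extend_inj_on_to_bij_betw[OF finite_N[of x], of ?K f] A(1) by (auto simp: bij_betw_def)
  obtain \<phi> where \<phi>: "aut \<phi>" "\<phi> x = x" "\<forall>y\<in>N x. \<phi> y = \<pi> y" using extend_star[OF x(1) \<pi>(1)] by blast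
  have "N x \<inter> N (\<phi> x') = \<phi> ` N x \<inter> \<phi> ` N x'"
    using aut_N[OF \<phi>(1) x(1)] aut_N[OF \<phi>(1) x(2)] \<phi>(2) by simp
  also have "\<dots> = \<phi> ` ?K"
    by (rule inj_on_image_Int[OF aut_inj[OF \<phi>(1)], symmetric]) (use E_V in auto)
  also have "\<dots> = f ` ?K" using \<phi>(3) \<pi>(2) by (intro image_cong) auto
  finally show ?thesis using f by (auto simp: bij_betw_def)
qed

text \<open>In the star at \<open>y\<close>, the leaf \<open>u\<close> can be exchanged for
  \<open>u'\<close> while \<open>x\<close> and \<open>x'\<close> stay fixed.\<close>

lemma card_triple_eq:
  assumes E: "E y x" "E y x'" "E y u" "E y u'" and ne: "u \<noteq> x" "u \<noteq> x'" "u' \<noteq> x" "u' \<noteq> x'"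
  shows "card (N x \<inter> N x' \<inter> N u) = card (N x \<inter> N x' \<inter> N u')"
proof -
  let ?S = "insert y {x, x'}"
  have yu: "y \<noteq> u" "y \<noteq> u'" using E not_E_refl by auto
  have nE: "\<not> E t v" if "t \<in> {x, x'}" "v \<in> {u, u'}" for t v using that E[THEN E_X_iff] E_X_iff[of t v] by auto
  have "\<exists>\<phi>. aut \<phi> \<and> (\<forall>t\<in>?S. \<phi> t = t) \<and> \<phi> u = u'"
  proof (rule extend_leaf[where s = y])
    show "graph_connected ?S E" by (rule graph_connected_star) (use E E[THEN sym] in auto)
    show "?S \<subseteq> V" using E[THEN E_V(1)] E[THEN E_V(2)] by auto
    show "E t u \<longleftrightarrow> E t u'" if "t \<in> ?S" for t using that nE E by auto
  qed (use ne yu E in auto)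
  then obtain \<phi> where \<phi>: "aut \<phi>" "\<phi> x = x" "\<phi> x' = x'" "\<phi> u = u'" by auto
  have V: "x \<in> V" "x' \<in> V" "u \<in> V" using E[THEN E_V(2)] by auto
  have inj: "inj_on \<phi> V" using aut_inj[OF \<phi>(1)] .
  have "N x \<inter> N x' \<inter> N u' = \<phi> ` N x \<inter> \<phi> ` N x' \<inter> \<phi> ` N u"
    using aut_N[OF \<phi>(1)] V \<phi> by metis
  also have "\<dots> = \<phi> ` (N x \<inter> N x') \<inter> \<phi> ` N u"
    using inj_on_image_Int[OF inj, of "N x" "N x'"] N_subset by auto
  also have "\<dots> = \<phi> ` (N x \<inter> N x' \<inter> N u)"
    by (rule inj_on_image_Int[OF inj, symmetric]) (use E_V in auto)
  finally show ?thesis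
    using card_image[OF inj_on_subset[OF inj]] N_subset[of x] by (metis inf.coboundedI1 inf_le1)
qed

text \<open>Exchanging one element of the common neighbourhood produces a third vertex meeting it in
  all but one point; by homogeneity of stars, so does every other third vertex.\<close>

lemma card_triple:
  assumes xx': "x \<noteq> x'" and E: "E x y" "E x' y" "E u y" and ne: "u \<noteq> x" "u \<noteq> x'"
    and k: "card (N x \<inter> N x') \<ge> 2" "card (N x \<inter> N x') < card (N x)"
  shows "Suc (card (N x \<inter> N x' \<inter> N u)) = card (N x \<inter> N x')"
proof -
  let ?K = "N x \<inter> N x'"
  have finK: "finite ?K" using finite_N by blast
  obtain y2 where y2: "y2 \<in> ?K" "y2 \<noteq> y" using ex_notin1[OF k(1), of y] by blast
  obtain y3 where y3: "y3 \<in> N x" "y3 \<notin> ?K" using ex_notin_if_card_less[OF k(2) finK] by blast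
  \<comment> \<open>Keeping \<open>y\<close> in the exchanged set makes \<open>v\<close> a neighbour
    of \<open>y\<close>, so that \<open>v\<close> and \<open>u\<close> can be compared by
    \<open>card_triple_eq\<close>.\<close>
  let ?A = "insert y3 (?K - {y2})"
  have cA: "card (?K - {y2}) = card ?K - 1" using y2 finK by (simp add: card_Diff_singleton)
  have "card ?A = card ?K" using cA y3 finK k(1) by simp
  moreover have "?A \<subseteq> N x" using y3 by auto
  ultimately obtain v where v: "N x \<inter> N v = ?A"
    using realise_common_neighbours[of x x' ?A] E E_V by blast
  have "y \<in> ?A" using E y2 by auto
  then have "E v y" using v by auto
  have "card (N x \<inter> N v) \<noteq> card (N x)" unfolding v using \<open>card ?A = card ?K\<close> k(2) by linarith
  then have "v \<noteq> x" by (metis Int_absorb)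
  moreover have "v \<noteq> x'" using v y3 by auto
  ultimately have "card (?K \<inter> N u) = card (?K \<inter> N v)"
    using card_triple_eq[of y x x' u v] E[THEN sym] \<open>E v y\<close>[THEN sym] ne by blast
  also have "?K \<inter> N v = ?K - {y2}" using v y3 by auto
  finally show ?thesis using cA k(1) by simp
qed

text \<open>Otherwise two common neighbours other than \<open>y\<close> can be exchanged for two
  outside ones. The resulting third vertex meets the common neighbourhood in two points fewer, while
  \<open>card_triple\<close> allows only one fewer.\<close>

lemma common_two_or_all_but_one:
  assumes xx': "x \<noteq> x'" and E: "E x y" "E x' y"
    and k: "card (N x \<inter> N x') \<ge> 2" "card (N x \<inter> N x') < card (N x)"
  shows "card (N x \<inter> N x') = 2 \<or> Suc (card (N x \<inter> N x')) = card (N x)"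
proof (rule ccontr)
  let ?K = "N x \<inter> N x'"
  assume "\<not> ?thesis"
  then have k3: "card ?K \<ge> 3" and a: "card (N x) \<ge> card ?K + 2" using k by auto
  have finK: "finite ?K" using finite_N by blast
  obtain y1 where y1: "y1 \<in> ?K" "y1 \<noteq> y" using ex_notin2[OF k3, of y y] by blast
  obtain y2 where y2: "y2 \<in> ?K" "y2 \<noteq> y" "y2 \<noteq> y1" using ex_notin2[OF k3, of y y1] by blast
  obtain z1 where z1: "z1 \<in> N x" "z1 \<notin> ?K" using ex_notin_if_card_less[OF k(2) finK] by blast
  have "card (insert z1 ?K) < card (N x)" using a z1 finK by simp
  then obtain z2 where z2: "z2 \<in> N x" "z2 \<notin> ?K" "z2 \<noteq> z1"
    using ex_notin_if_card_less[of "insert z1 ?K" "N x"] finK by auto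
  let ?A = "insert z1 (insert z2 (?K - {y1, y2}))"
  have c: "card (?K - {y1, y2}) = card ?K - 2"
    using y1 y2 finK by (simp add: card_Diff_subset)
  then have "card ?A = card ?K" using z1 z2 finK k3 by simp
  moreover have "?A \<subseteq> N x" using z1 z2 by auto
  ultimately obtain v where v: "N x \<inter> N v = ?A"
    using realise_common_neighbours[of x x' ?A] E E_V by blast
  have "y \<in> ?A" using E y1 y2 by auto
  then have "E v y" using v by auto
  have "card (N x \<inter> N v) \<noteq> card (N x)" unfolding v using \<open>card ?A = card ?K\<close> k(2) by linarith
  then have "v \<noteq> x" by (metis Int_absorb)
  moreover have "v \<noteq> x'" using v z1 by auto
  ultimately have "Suc (card (?K \<inter> N v)) = card ?K"
    using card_triple[OF xx' E \<open>E v y\<close> _ _ k] by blast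
  moreover have "?K \<inter> N v = ?K - {y1, y2}" using v z1 z2 by auto
  ultimately show False using c k3 by simp
qed

text \<open>The neighbourhoods of \<open>x0\<close> and \<open>y0\<close> together are closed under
  neighbours, and all vertices of \<open>X\<close> have the neighbourhood of
  \<open>x0\<close>.\<close>

lemma equal_neighbourhoods_complete:
  assumes x0: "x0 \<in> X" "E x0 y0" and N: "\<And>x x' y. x \<in> X \<Longrightarrow> E x y \<Longrightarrow> E x' y \<Longrightarrow> N x = N x'"
  shows "\<exists>m n. graph_isomorphic V E {0..<m+n} (Kmn_E m n)"
proof -
  have V: "N x0 \<union> N y0 = V"
  proof (rule closed_eq_V[of y0])
    show "y0 \<in> N x0 \<union> N y0" using x0 by simp
    show "N x0 \<union> N y0 \<subseteq> V" using N_subset by blast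
    fix u v assume u: "u \<in> N x0 \<union> N y0" and uv: "E u v"
    show "v \<in> N x0 \<union> N y0"
    proof (cases "E x0 u")
      case True
      then have "N x0 = N v" using N x0 sym[OF uv] by blast
      then have "E v y0" using x0 by auto
      then show ?thesis using sym by simp
    next
      case False
      then have "E u y0" using u sym by blast
      then have "N x0 = N u" using N x0 by blast
      then show ?thesis using uv by auto
    qed
  qed
  have "finite V" using finite_N V by (metis finite_Un)
  moreover have "E x y" if "x \<in> X" "y \<in> Y" for x y
  proof -
    have "\<not> E x0 x" "\<not> E y0 y" using that x0 not_E_XX not_E_YY E_XY by blast+
    then have "E y0 x" "E x0 y" using that V X_V Y_V by blast+
    then have "N x0 = N x" using N x0 sym by blast
    with \<open>E x0 y\<close> show ?thesis by auto
  qed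
  ultimately show ?thesis by (rule complete_isomorphic)
qed

text \<open>For each neighbour \<open>z\<close> of \<open>x\<close>, one vertex \<open>g z\<close>
  misses just \<open>z\<close> among the neighbours of \<open>x\<close> and has one neighbour
  outside them. That outside neighbour is the same \<open>s\<close> for all \<open>z\<close>; the
  matching pairs \<open>z\<close> with \<open>g z\<close> and \<open>s\<close> with
  \<open>x\<close>.\<close>

lemma all_but_one_common_matching_complement:
  assumes x: "x \<in> X" and xx': "x \<noteq> x'" and E: "E x y" "E x' y"
    and k: "card (N x \<inter> N x') \<ge> 2" and a: "Suc (card (N x \<inter> N x')) = card (N x)"
  shows "\<exists>n. graph_isomorphic V E {0..<2*n} (cpm_E n)"
proof -
  define k where "k = card (N x \<inter> N x')"
  have k2: "k \<ge> 2" and degx: "card (N x) = Suc k" using k a unfolding k_def by auto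
  have deg: "card (N u) = Suc k" if "u \<in> X" for u
    using card_N_eq[of u x] that x X_V degx by simp
  have common: "card (N u \<inter> N v) = k" if "u \<in> X" "u \<noteq> v" "E u z" "E v z" for u v z
  proof -
    have "z \<in> Y" "y \<in> Y" using that x E E_XY by blast+
    then show ?thesis unfolding k_def
      using card_common_eq[of z u v y x x'] that E xx' sym not_XY by blast
  qed
  have "\<exists>u. N x \<inter> N u = N x - {z}" if "E x z" for z
    using realise_common_neighbours[of x x' "N x - {z}"] that E E_V(1) degx finite_N[of x]
    by (auto simp: k_def card_Diff_singleton)
  then obtain g where g: "\<And>z. E x z \<Longrightarrow> N x \<inter> N (g z) = N x - {z}" by metis
  have gE: "E (g z) w \<longleftrightarrow> w \<noteq> z" if "E x z" "E x w" for z w using g[OF that(1)] that(2) by auto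
  have other: "\<exists>w. E x w \<and> w \<noteq> z \<and> w \<noteq> z'" for z z'
    using ex_notin2[of "N x" z z'] degx k2 by auto
  have gX: "g z \<in> X" if "E x z" for z
  proof -
    obtain w where "E x w" "w \<noteq> z" using other by blast
    then show ?thesis using gE[OF that] x E_X_iff by metis
  qed
  have gx: "g z \<noteq> x" if "E x z" for z using gE[OF that that] that by auto
  have g_inj: "z = z'" if "E x z" "E x z'" "g z = g z'" for z z' using gE that by metis
  \<comment> \<open>\<open>u\<close> misses exactly one neighbour \<open>z\<close> of
    \<open>x\<close>. If it differed from \<open>g z\<close>, the triple intersection would be as
    large as the double one, against \<open>card_triple\<close>.\<close>
  have g_surj: "\<exists>z. E x z \<and> u = g z" if u: "u \<noteq> x" "E u w" "E x w" for u w
  proof -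
    have ck: "card (N x \<inter> N u) = k" using common[OF x u(1)[symmetric] u(3,2)] .
    have "card (N x - N x \<inter> N u) = 1"
      using ck degx finite_N by (subst card_Diff_subset) auto
    then obtain z where z: "N x - N x \<inter> N u = {z}" using card_1_singletonE by blast
    then have xz: "E x z" by auto
    have eq: "N x \<inter> N u = N x \<inter> N (g z)" using g[OF xz] z by blast
    have "u = g z"
    proof (rule ccontr)
      assume ne: "u \<noteq> g z"
      have "E (g z) w" using eq u by auto
      then have "Suc (card (N x \<inter> N u \<inter> N (g z))) = card (N x \<inter> N u)"
        using ck k2 degx u gx[OF xz] ne by (intro card_triple[of x u w "g z"]) auto
      moreover have "N x \<inter> N u \<inter> N (g z) = N x \<inter> N u" using eq by auto
      ultimately show False by simp
    qed
    with xz show ?thesis by blast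
  qed
  have single: "\<exists>s. N (g z) - N x = {s}" if "E x z" for z
  proof -
    have "card (N x \<inter> N (g z)) = k" using g[OF that] degx finite_N[of x] that by (simp add: card_Diff_singleton)
    then have "card (N (g z) \<inter> N x) = k" by (simp add: Int_commute)
    then have "card (N (g z) - N x) = 1"
      using card_Diff_subset_Int[of "N (g z)" "N x"] deg[OF gX[OF that]] finite_N by simp
    then show ?thesis using card_1_singletonE by metis
  qed
  \<comment> \<open>Of the \<open>k\<close> common neighbours of \<open>g z\<close> and
    \<open>g z'\<close>, only \<open>k - 1\<close> lie in \<open>N x\<close>, which has
    \<open>k + 1\<close> elements of which two are missed.\<close>
  have meet: "\<exists>t. E (g z) t \<and> E (g z') t \<and> \<not> E x t" if zz': "E x z" "E x z'" "z \<noteq> z'" for z z'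
  proof -
    obtain w where w: "E x w" "w \<noteq> z" "w \<noteq> z'" using other by blast
    have "card (N (g z) \<inter> N (g z')) = k"
      using common[OF gX[OF zz'(1)], of "g z'" w] gE[OF zz'(1) w(1)] gE[OF zz'(2) w(1)] w g_inj zz' by blast
    moreover have "card (N x - {z, z'}) = k - 1"
      using zz' finite_N[of x] degx by (simp add: card_Diff_subset)
    ultimately obtain t where t: "t \<in> N (g z) \<inter> N (g z')" "t \<notin> N x - {z, z'}"
      using ex_notin_if_card_less[of "N x - {z, z'}" "N (g z) \<inter> N (g z')"] k2 finite_N by auto
    then have "\<not> E x t" using gE[OF zz'(1), of t] gE[OF zz'(2), of t] by auto
    then show ?thesis using t by blast
  qed
  obtain s where s: "N (g y) - N x = {s}" using single[OF E(1)] by blast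
  have s_all: "N (g z) - N x = {s}" if z: "E x z" for z
  proof (cases "z = y")
    case False
    obtain t where "E (g z) t" "E (g y) t" "\<not> E x t" using meet[OF z E(1) False] by blast
    then have "t \<in> N (g z) - N x" "t \<in> N (g y) - N x" by auto
    then show ?thesis using s single[OF z] by (metis singletonD)
  qed (use s in simp)
  have sE: "E (g z) s" if "E x z" for z using s_all[OF that] by blast
  have sx: "\<not> E x s" using s by blast
  have sY: "s \<in> Y" using sE[OF E(1)] gX[OF E(1)] E_XY by blast
  have Ng: "w = s \<or> E x w" if "E x z" "E (g z) w" for z w using s_all[OF that(1)] that(2) by blast
  have V: "insert x (g ` N x) \<union> insert s (N x) = V"
  proof (rule closed_eq_V[of x])
    show "x \<in> insert x (g ` N x) \<union> insert s (N x)" by simp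
    show "insert x (g ` N x) \<union> insert s (N x) \<subseteq> V" using x gX sY X_V Y_V N_subset by auto
    fix u v assume u: "u \<in> insert x (g ` N x) \<union> insert s (N x)" and uv: "E u v"
    consider "u = x" | z where "E x z" "u = g z" | "E x u" | "u = s" using u by blast
    then show "v \<in> insert x (g ` N x) \<union> insert s (N x)"
    proof cases
      case 1
      then show ?thesis using uv by simp
    next
      case 2
      then show ?thesis using Ng uv by blast
    next
      case 3
      then show ?thesis using g_surj[of v u] sym[OF uv] by blast
    next
      case 4
      show ?thesis
      proof (cases "v = g y")
        case False
        \<comment> \<open>As \<open>k\<close> is at least two, \<open>v\<close> and
          \<open>g y\<close> share a neighbour besides \<open>s\<close>. It lies in
          \<open>N x\<close>, which brings \<open>v\<close> within reach of
          \<open>g_surj\<close>.\<close>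
        have "card (N (g y) \<inter> N v) \<ge> 2"
          using common[OF gX[OF E(1)] False[symmetric] sE[OF E(1)]] sym[OF uv] 4 k2 by simp
        from ex_notin1[OF this, of s] obtain t where "E (g y) t" "E v t" "t \<noteq> s" by blast
        then have "v = x \<or> (\<exists>z. E x z \<and> v = g z)" using Ng[OF E(1)] g_surj by blast
        then show ?thesis by blast
      qed (use E in auto)
    qed
  qed
  have NY: "N x \<subseteq> Y" using x E_XY by blast
  have X_eq: "X = insert x (g ` N x)" and Y_eq: "Y = insert s (N x)"
  proof -
    have *: "insert x (g ` N x) \<subseteq> X" "insert s (N x) \<subseteq> Y" using x gX sY NY by auto
    show "X = insert x (g ` N x)" "Y = insert s (N x)" using * V V_eq not_XY by blast+
  qed
  interpret swapped: homogeneous_bipartite V E Y X by (rule homogeneous_swap)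
  let ?\<theta> = "\<lambda>w. if w = s then x else g w"
  have "bij_betw ?\<theta> Y X"
    unfolding bij_betw_def
  proof
    show "inj_on ?\<theta> Y" unfolding Y_eq inj_on_def using gx g_inj sx by auto
    show "?\<theta> ` Y = X" unfolding X_eq Y_eq using sx by auto
  qed
  moreover have "E w u \<longleftrightarrow> u \<noteq> ?\<theta> w" if "w \<in> Y" "u \<in> X" for w u
  proof -
    have "E u w \<longleftrightarrow> u \<noteq> ?\<theta> w"
      using that unfolding X_eq Y_eq using sx sE gx gE g_inj by auto
    then show ?thesis using E_commute by blast
  qed
  moreover have "finite V" using V finite_N[of x] by (metis finite_Un finite_imageI finite_insert)
  ultimately show ?thesis by (intro swapped.matching_complement_isomorphic)
qed

text \<open>The local structure left over is that of a biplane: \<open>x\<close>, \<open>x'\<close> have the common neighbours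
  \<open>y1\<close>, \<open>y2\<close>. Among the neighbours of \<open>z\<close> not adjacent to \<open>y1\<close>, exactly one is adjacent to \<open>y2\<close>,
  but all of them extend the path \<open>x, y1, x', z\<close> in the same way.\<close>

lemma no_biplane:
  assumes x: "x \<in> X" "x' \<in> X" "x \<noteq> x'" and two: "card (N x \<inter> N x') = 2" and degx: "card (N x) \<ge> 4"
    and y: "y \<in> Y" "y' \<in> Y" "y \<noteq> y'" and twoy: "card (N y \<inter> N y') = 2" and degy: "card (N y) \<ge> 4"
  shows False
proof -
  obtain y1 y2 where K: "N x \<inter> N x' = {y1, y2}" "y1 \<noteq> y2" using two card_2_iff by metis
  then have E: "E x y1" "E x y2" "E x' y1" "E x' y2" by auto
  have "N y \<inter> N y' \<noteq> {}" using twoy by (metis card.empty zero_neq_numeral)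
  then obtain u0 where u0: "E y u0" "E y' u0" by blast
  \<comment> \<open>The biplane property: in either part, two vertices with one common neighbour
    have exactly two.\<close>
  have cX: "card (N u \<inter> N v) = 2" if "u \<in> X" "u \<noteq> v" "E u w" "E v w" for u v w
  proof -
    have "w \<in> Y" "y1 \<in> Y" using that x E E_XY by blast+
    then show ?thesis using card_common_eq[of w u v y1 x x'] that E x sym not_XY two by metis
  qed
  have cY: "card (N u \<inter> N v) = 2" if "u \<in> Y" "u \<noteq> v" "E u w" "E v w" for u v w
  proof -
    have "w \<in> X" "u0 \<in> X" using that y u0 E_YX by blast+
    then show ?thesis using card_common_eq[of w u v u0 y y'] that u0 y sym twoy by metis
  qed
  have "card (N x') \<ge> 4" using card_N_eq[of x x'] x X_V degx by simp
  then obtain z where z: "E x' z" "\<not> E x z"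
    using ex_notin2[of "N x'" y1 y2] K by auto
  have Y: "y1 \<in> Y" "y2 \<in> Y" "z \<in> Y" using x E z E_XY by blast+
  have zy: "z \<noteq> y1" "z \<noteq> y2" using z E by auto
  have partner: "\<exists>u. N z \<inter> N w = {x', u} \<and> u \<noteq> x'" if "E x' w" "w \<noteq> z" for w
  proof -
    have "card (N z \<inter> N w) = 2" using cY[OF Y(3), of w x'] that z sym by blast
    then obtain p q where pq: "N z \<inter> N w = {p, q}" "p \<noteq> q" using card_2_iff by metis
    moreover have "x' \<in> N z \<inter> N w" using that z sym by auto
    ultimately have "x' = p \<or> x' = q" by auto
    then show ?thesis using pq by (auto simp: insert_commute)
  qed
  obtain u1 where u1: "N z \<inter> N y1 = {x', u1}" "u1 \<noteq> x'" using partner[OF E(3)] zy by blast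
  obtain u2 where u2: "N z \<inter> N y2 = {x', u2}" "u2 \<noteq> x'" using partner[OF E(4)] zy by blast
  have u12: "E z u1" "E y1 u1" "E z u2" "E y2 u2" using u1 u2 by auto
  have "u1 \<noteq> u2"
  proof
    assume eq: "u1 = u2"
    have "card (N x' \<inter> N u1) = 2" using cX[OF x(2) u1(2)[symmetric] E(3)] u12 sym by blast
    moreover have "{y1, y2, z} \<subseteq> N x' \<inter> N u1" using E z u12 eq sym by auto
    moreover have "card {y1, y2, z} = 3" using K zy by auto
    moreover have "finite (N x' \<inter> N u1)" using finite_N by blast
    ultimately show False using card_mono[of "N x' \<inter> N u1" "{y1, y2, z}"] by simp
  qed
  have "card (N z) \<ge> 4" using card_N_eq[of z y] Y y Y_V in_Y_iff degy by metis
  moreover have "card {x', u1, u2} \<le> 3" by (simp add: card_insert_if)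
  \<comment> \<open>Degree at least four on the side of \<open>Y\<close> leaves a neighbour of
    \<open>z\<close> that is adjacent to neither \<open>y1\<close> nor \<open>y2\<close>.\<close>
  ultimately obtain w where w: "E z w" "w \<notin> {x', u1, u2}"
    using ex_notin_if_card_less[of "{x', u1, u2}" "N z"] by auto
  have nadj: "\<not> E y1 w" "\<not> E y2 w" "\<not> E y1 u2" using u1 u2 w u12 \<open>u1 \<noteq> u2\<close> by auto
  have uX: "u2 \<in> X" "w \<in> X" using Y u12 w E_YX by blast+
  let ?S = "insert z (insert y1 {x, x'})"
  have "\<exists>\<phi>. aut \<phi> \<and> (\<forall>t\<in>?S. \<phi> t = t) \<and> \<phi> u2 = w"
  proof (rule extend_leaf[where s = z])
    show "graph_connected ?S E"
      by (intro graph_connected_insert[of _ _ x'] graph_connected_star)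
        (use E E[THEN sym] z(1) z(1)[THEN sym] in auto)
    show "?S \<subseteq> V" using x Y X_V Y_V by auto
    show "u2 \<notin> ?S" "w \<notin> ?S" using uX Y not_XY u2 w z u12 sym by blast+
    show "E t u2 \<longleftrightarrow> E t w" if "t \<in> ?S" for t
      using that nadj u12 w not_E_XX[OF _ uX(1)] not_E_XX[OF _ uX(2)] x by auto
  qed (use u12 in auto)
  then obtain \<phi> where \<phi>: "aut \<phi>" "\<phi> x = x" "\<phi> x' = x'" "\<phi> y1 = y1" "\<phi> u2 = w" by auto
  \<comment> \<open>Fixing \<open>x\<close>, \<open>x'\<close> and \<open>y1\<close> forces
    \<open>\<phi>\<close> to fix \<open>y2\<close>, their only other common neighbour. Then the edge
    from \<open>y2\<close> to \<open>u2\<close> goes to one from \<open>y2\<close> to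
    \<open>w\<close>.\<close>
  have "\<phi> y2 \<in> {y1, y2}"
    using aut_E[OF \<phi>(1) E(2)] aut_E[OF \<phi>(1) E(4)] \<phi> unfolding K(1)[symmetric] by simp
  moreover have "\<phi> y2 \<noteq> y1" using aut_inj[OF \<phi>(1)] K(2) \<phi>(4) Y Y_V unfolding inj_on_def by metis
  ultimately have "E y2 w" using aut_E[OF \<phi>(1) u12(4)] \<phi>(5) by simp
  with nadj show False by blast
qed

text \<open>With \<open>k\<close> common neighbours and degree \<open>a\<close>, the cases are
  \<open>k = a\<close>, \<open>k = a - 1\<close> and the remaining \<open>k = 2\<close>, where
  \<open>a\<close> is then at least four.\<close>

lemma square_trichotomy:
  assumes x: "x \<in> X" and sq: "x \<noteq> x'" "y \<noteq> y'" "E x y" "E x y'" "E x' y" "E x' y'"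
  shows "(\<exists>m n. graph_isomorphic V E {0..<m+n} (Kmn_E m n)) \<or>
    (\<exists>n. graph_isomorphic V E {0..<2*n} (cpm_E n)) \<or>
    card (N x \<inter> N x') = 2 \<and> card (N x) \<ge> 4"
proof -
  have fin: "finite (N x \<inter> N x')" using finite_N by blast
  have "card {y, y'} \<le> card (N x \<inter> N x')" using sq by (intro card_mono fin) auto
  then have k: "card (N x \<inter> N x') \<ge> 2" using sq by simp
  consider "card (N x \<inter> N x') = card (N x)" | "card (N x \<inter> N x') < card (N x)"
    using card_mono[OF finite_N, of "N x \<inter> N x'" x] by fastforce
  then show ?thesis
  proof cases
    case 1
    have "N u = N v" if u: "u \<in> X" "E u w" "E v w" for u v w
    proof (cases "u = v")
      case False
      have wy: "w \<in> Y" "y \<in> Y" using u x sq E_XY by blast+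
      then have "v \<in> X" using E_YX sym u by blast
      have "card (N u \<inter> N v) = card (N x)"
        using card_common_eq[of w u v y x x'] wy u False sq sym not_XY 1 by metis
      moreover have "card (N u) = card (N x)" "card (N v) = card (N x)"
        using card_N_eq[of u x] card_N_eq[of v x] x u \<open>v \<in> X\<close> X_V by blast+
      ultimately have "N u \<inter> N v = N u" "N u \<inter> N v = N v"
        by (metis card_subset_eq finite_N inf_le1, metis card_subset_eq finite_N inf_le2)
      then show ?thesis by simp
    qed simp
    then show ?thesis using equal_neighbourhoods_complete[OF x sq(3)] by blast
  next
    case 2
    then show ?thesis
      using common_two_or_all_but_one[OF sq(1,3,5) k 2] all_but_one_common_matching_complement[OF x sq(1,3,5) k] by auto
  qed
qed

text \<open>A square has a pair of vertices in each part, so the trichotomy applies to both parts;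
  if both give the last alternative, \<open>no_biplane\<close> applies.\<close>

lemma square_classification:
  assumes sq: "x \<noteq> x'" "y \<noteq> y'" "E x y" "E x y'" "E x' y" "E x' y'"
  shows "(\<exists>m n. graph_isomorphic V E {0..<m+n} (Kmn_E m n)) \<or>
    (\<exists>n. graph_isomorphic V E {0..<2*n} (cpm_E n))"
proof -
  interpret swapped: homogeneous_bipartite V E Y X by (rule homogeneous_swap)
  have main: ?thesis if "x \<in> X" "x \<noteq> x'" "y \<noteq> y'" "E x y" "E x y'" "E x' y" "E x' y'" for x x' y y'
  proof -
    have sd: "y \<in> Y" "y' \<in> Y" "x' \<in> X" using that E_XY E_X_iff by blast+
    have "E y x" "E y x'" "E y' x" "E y' x'" using that sym by blast+
    with square_trichotomy[OF that] swapped.square_trichotomy[of y y' x x'] no_biplane[of x x' y y'] sd that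
    show ?thesis by blast
  qed
  show ?thesis
  proof (cases "x \<in> X")
    case True
    then show ?thesis using main sq by blast
  next
    case False
    then have "y \<in> X" using E_X_iff sq by blast
    then show ?thesis using main[of y y' x x'] sq sym by blast
  qed
qed

end

section \<open>The classification\<close>

context homogeneous_bipartite
begin

lemma leaf_isomorphic_complete:
  assumes x: "x \<in> X" "card (N x) \<le> 1" and fin: "finite V"
  shows "\<exists>m n. graph_isomorphic V E {0..<m+n} (Kmn_E m n)"
proof (rule complete_isomorphic[OF fin])
  have "card (N u) \<le> 1" if "u \<in> X" for u using card_N_eq[of u x] that x X_V by simp
  then show "E u y" if "u \<in> X" "y \<in> Y" for u y
    using leaf_side_complete[OF finite_N _ that] by blast
qed

lemma cycle_list_card_hd:
  assumes "cycle_list E ps" shows "card (N (hd ps)) \<ge> 2"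
proof -
  obtain a b zs where ps: "ps = a # b # zs" "zs \<noteq> []"
    using assms unfolding cycle_list_def by (cases ps; cases "tl ps") (auto simp: Suc_le_eq)
  then have "{b, last zs} \<subseteq> N a" "b \<noteq> last zs"
    using assms sym unfolding cycle_list_def by auto
  then show ?thesis using card_mono[OF finite_N, of "{b, last zs}" a] ps by simp
qed

text \<open>Two consecutive vertices of the cycle represent both parts, each part has constant
  degree, and a vertex on a cycle has at least two neighbours.\<close>

lemma cycle_list_min_degree:
  assumes cyc: "cycle_list E ps" and v: "v \<in> V" shows "card (N v) \<ge> 2"
proof -
  obtain a b zs where ps: "ps = a # b # zs"
    using assms unfolding cycle_list_def by (cases ps; cases "tl ps") auto
  have "card (N a) \<ge> 2" "card (N b) \<ge> 2"
    using cycle_list_card_hd[OF cyc] cycle_list_card_hd[OF cycle_list_rotate1[OF cyc]] ps by auto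
  moreover have ab: "E a b" using cyc ps unfolding cycle_list_def by simp
  moreover have "(a \<in> X \<longleftrightarrow> v \<in> X) \<or> (b \<in> X \<longleftrightarrow> v \<in> X)" using E_X_iff[OF ab] by blast
  ultimately show ?thesis using card_N_eq[of a v] card_N_eq[of b v] E_V[OF ab] v by auto
qed

lemma classification:
  "(\<exists>m. even m \<and> m \<ge> 4 \<and> graph_isomorphic V E {0..<m} (cycle_E m)) \<or>
    (\<exists>a b. is_T V E X Y a b) \<or>
    (\<exists>m n. graph_isomorphic V E {0..<m+n} (Kmn_E m n)) \<or>
    (\<exists>n. graph_isomorphic V E {0..<2*n} (cpm_E n))"
proof -
  interpret swapped: homogeneous_bipartite V E Y X by (rule homogeneous_swap)
  show ?thesis
  proof (cases "graph_acyclic V E")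
    case ac: True
    show ?thesis
    proof (cases "finite V")
      case True
      obtain v where "v \<in> V" "card (N v) \<le> 1" using finite_acyclic_leaf[OF True ac] by blast
      then show ?thesis
        using leaf_isomorphic_complete[of v] swapped.leaf_isomorphic_complete[of v] True in_Y_iff by blast
    next
      case False
      have "\<exists>a. \<forall>x\<in>X. card (N x) = a" using card_N_eq X_V by blast
      moreover have "\<exists>b. \<forall>y\<in>Y. card (N y) = b" using swapped.card_N_eq Y_V by blast
      ultimately obtain a b where "\<forall>x\<in>X. card (N x) = a" "\<forall>y\<in>Y. card (N y) = b" by blast
      then have "is_T V E X Y a b"
        unfolding is_T_def neighbours_eq using False conn ac finite_N by simp
      then show ?thesis by blast
    qed
  next
    case False
    then obtain cs where cs: "cycle_list E cs" using graph_acyclic_iff by blast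
    have deg: "card (N v) \<ge> 2" if "v \<in> V" for v using cycle_list_min_degree[OF cs that] .
    show ?thesis
    proof (cases "\<exists>v\<in>V. card (N v) \<ge> 3")
      case True
      then obtain v where v: "v \<in> V" "card (N v) \<ge> 3" by blast
      \<comment> \<open>The part with degree at least three has to take the role of \<open>Y\<close>
        in \<open>cycle_has_square\<close>, if necessary after exchanging the parts.\<close>
      have "\<exists>x x' y y'. x \<noteq> x' \<and> y \<noteq> y' \<and> E x y \<and> E x y' \<and> E x' y \<and> E x' y'"
      proof (cases "v \<in> Y")
        case True
        then have "card (N y) \<ge> 3" if "y \<in> Y" for y
          using that v swapped.card_N_eq[of y v] Y_V by simp
        then show ?thesis using cycle_has_square[OF cs] deg X_V by blast
      next
        case False
        then have "card (N x) \<ge> 3" if "x \<in> X" for x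
          using that v card_N_eq[of x v] X_V in_Y_iff by simp
        then show ?thesis using swapped.cycle_has_square[OF cs] deg Y_V by blast
      qed
      then show ?thesis using square_classification by blast
    next
      case False
      then have "card (N v) \<le> 2" if "v \<in> V" for v using that by force
      then have "graph_isomorphic V E {0..<length cs} (cycle_E (length cs))"
        using two_regular_cycle[OF cs finite_N] by blast
      moreover have "even (length cs)" using cycle_list_even[OF cs] .
      moreover from this have "length cs \<noteq> 3" by auto
      then have "length cs \<ge> 4" using cs unfolding cycle_list_def by linarith
      ultimately show ?thesis by blast
    qed
  qed
qed

end

text \<open>The tree clause describes \<open>T_{a,b}\<close> by its defining properties relative to
  the given parts. The bound \<open>m \<ge> 4\<close> excludes the degenerate
  \<open>cycle_E 2\<close>, a single edge, which is listed as \<open>Kmn_E 1 1\<close>.\<close>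

theorem theorem4p6:
  fixes V :: "'a set" and E :: "'a \<Rightarrow> 'a \<Rightarrow> bool" and X Y :: "'a set"
  assumes "bipartite_graph V E X Y"
    and "graph_connected V E"
  shows "(locally_finite V E \<and> c_homogeneous_bipartite V E X Y) \<longleftrightarrow>
    ((\<exists>m::nat. even m \<and> m \<ge> 4 \<and> graph_isomorphic V E {0..<m} (cycle_E m))
     \<or> (\<exists>a b::nat. is_T V E X Y a b)
     \<or> (\<exists>m n::nat. graph_isomorphic V E {0..<m+n} (Kmn_E m n))
     \<or> (\<exists>n::nat. graph_isomorphic V E {0..<2*n} (cpm_E n)))"
    (is "?L \<longleftrightarrow> ?R")
proof
  interpret connected_bipartite V E X Y using assms by unfold_locales
  assume ?L
  then interpret homogeneous_bipartite V E X Y by unfold_locales auto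
  show ?R by (rule classification)
next
  interpret connected_bipartite V E X Y using assms by unfold_locales
  have fin: "locally_finite V E" if "finite V" using that unfolding locally_finite_def by simp
  have tree: ?L if "is_T V E X Y a b" for a b
  proof
    have T: "graph_acyclic V E" "\<And>x. x \<in> X \<Longrightarrow> finite (N x) \<and> card (N x) = a"
      "\<And>y. y \<in> Y \<Longrightarrow> finite (N y) \<and> card (N y) = b"
      using that unfolding is_T_def neighbours_eq by blast+
    show "c_homogeneous_bipartite V E X Y" using tree_c_homogeneous[OF T] .
    show "locally_finite V E" unfolding locally_finite_def neighbours_eq using T(2,3) in_Y_iff by blast
  qed
  assume ?R
  then show ?L
    using cycle_c_homogeneous tree Kmn_c_homogeneous cpm_c_homogeneous fin by blast
qed

end
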